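(* Let $\{H^s_j\}_{s\in\Sigma}$, $j=0,1$, be two families of Banach spaces and $A_j:H^\infty_j\to H^\infty_{1-j}$, $j=0,1$, two operators satisfying the assumptions in the context. Then there exist finite-dimensional subspaces $V_j\subset H^\infty_j$, $j=0,1$, such that, for every $s\in\Sigma$, $$\ker A_0^s=V_0,\qquad H_1^s=V_1\oplus\mathrm{im}\,A_0^s.$$ In particular, the index $\mathrm{ind}\,A_0^s=\dim V_0-\dim V_1$ does not depend on $s$. Moreover, if $A_0^s$ is invertible for some $s\in\Sigma$, then it is invertible for all $s\in\Sigma$.
   Context: Let $\Sigma\subset\mathbb R^n$ and let $\{H^s_j\}_{s\in\Sigma}$, $j=0,1$, be two families of Banach spaces such that, for every $s\in\Sigma$ and $j=0,1$: (1) $H^\infty_j:=\bigcap_{s\in\Sigma}H^s_j$ is a dense subspace of $H^s_j$; (2) any continuous operator $T:H^s_j\to H^s_j$ with $\mathrm{im}\,T\subset H^\infty_j$ is compact. Let $A_j:H^\infty_j\to H^\infty_{1-j}$, $j=0,1$, be two (linear) operators that extend by continuity to operators $A_j^s:H^s_j\to H^s_{1-j}$ for all $s\in\Sigma$, and such that $C_j:=1-A_{1-j}A_j:H^\infty_j\to H^\infty_j$ are regularizing, i.e. their continuous extensions $C^s_j:H^s_j\to H^s_j$ satisfy $\mathrm{im}\,C^s_j\subset H^\infty_j$ for all $s\in\Sigma$. *)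

theory Defs
  imports "HOL-Analysis.Analysis"
begin

text \<open>
  The members of a family of Banach spaces carry different norms but have to be intersected with
  each other.  They are therefore linear subspaces \<open>X\<close> of one ambient vector space (for instance a
  space of distributions), each with its own norm \<open>N\<close>.  The ambient space carries no topology, and
  \<open>N\<close> is only meaningful on \<open>X\<close>.  Scalars range over a type of sort
  \<open>{real_normed_field, heine_borel}\<close>, which covers both \<open>real\<close> and \<open>complex\<close>.
\<close>

subsection \<open>Banach spaces inside an ambient vector space\<close>

definition normed_on ::
  "('k::real_normed_field \<Rightarrow> 'a::ab_group_add \<Rightarrow> 'a) \<Rightarrow> 'a set \<Rightarrow> ('a \<Rightarrow> real) \<Rightarrow> bool" where
  "normed_on smul X N \<longleftrightarrow>
     vector_space smul \<and> module.subspace smul X \<and>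
     (\<forall>x\<in>X. 0 \<le> N x) \<and>
     (\<forall>x\<in>X. N x = 0 \<longleftrightarrow> x = 0) \<and>
     (\<forall>c. \<forall>x\<in>X. N (smul c x) = norm c * N x) \<and>
     (\<forall>x\<in>X. \<forall>y\<in>X. N (x + y) \<le> N x + N y)"

text \<open>
  The value 0 off \<open>X\<close> is only there because \<^locale>\<open>Metric_space\<close> asks for a distance that is
  nonnegative and symmetric on the whole type.
\<close>

definition norm_dist :: "'a::ab_group_add set \<Rightarrow> ('a \<Rightarrow> real) \<Rightarrow> 'a \<Rightarrow> 'a \<Rightarrow> real" where
  "norm_dist X N x y = (if x \<in> X \<and> y \<in> X then N (x - y) else 0)"

lemma Metric_space_norm_dist:
  fixes smul :: "'k::real_normed_field \<Rightarrow> 'a::ab_group_add \<Rightarrow> 'a"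
  assumes "normed_on smul X N"
  shows "Metric_space X (norm_dist X N)"
proof -
  note norm_axioms = assms[unfolded normed_on_def]
  have norm_smul: "N (smul c x) = norm c * N x" if "x \<in> X" for c x
    using norm_axioms that by blast
  have norm_triangle: "N (x + y) \<le> N x + N y" if "x \<in> X" "y \<in> X" for x y
    using norm_axioms that by blast
  interpret vector_space smul
    using norm_axioms by blast
  have sub: "subspace X"
    using norm_axioms by blast
  have diff: "x - y \<in> X" if "x \<in> X" "y \<in> X" for x y
    using sub that by (rule subspace_diff)
  have comm: "N (x - y) = N (y - x)" if "x \<in> X" "y \<in> X" for x y
    using norm_smul[OF diff[OF that], of "- 1"] by simp
  have tri: "N (x - z) \<le> N (x - y) + N (y - z)" if "x \<in> X" "y \<in> X" "z \<in> X" for x y z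
    using norm_triangle[of "x - y" "y - z"] diff that by simp
  have nonneg: "0 \<le> N x" and zero: "N x = 0 \<longleftrightarrow> x = 0" if "x \<in> X" for x
    using conjunct1[OF norm_axioms[THEN conjunct2, THEN conjunct2]] norm_axioms[THEN conjunct2, THEN conjunct2, THEN conjunct2, THEN conjunct1] that by auto
  show ?thesis
  proof
    show "0 \<le> norm_dist X N x y" for x y
      unfolding norm_dist_def using nonneg[OF diff] by auto
    show "norm_dist X N x y = norm_dist X N y x" for x y
      unfolding norm_dist_def using comm[of x y] by auto
    show "norm_dist X N x y = 0 \<longleftrightarrow> x = y" if "x \<in> X" "y \<in> X" for x y
      unfolding norm_dist_def using zero[OF diff[OF that]] that by auto
    show "norm_dist X N x z \<le> norm_dist X N x y + norm_dist X N y z"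
      if "x \<in> X" "y \<in> X" "z \<in> X" for x y z
      unfolding norm_dist_def using tri[OF that] that by simp
  qed
qed

abbreviation norm_topology :: "'a::ab_group_add set \<Rightarrow> ('a \<Rightarrow> real) \<Rightarrow> 'a topology" where
  "norm_topology X N \<equiv> Metric_space.mtopology X (norm_dist X N)"

definition banach_on ::
  "('k::real_normed_field \<Rightarrow> 'a::ab_group_add \<Rightarrow> 'a) \<Rightarrow> 'a set \<Rightarrow> ('a \<Rightarrow> real) \<Rightarrow> bool" where
  "banach_on smul X N \<longleftrightarrow> normed_on smul X N \<and> Metric_space.mcomplete X (norm_dist X N)"

subsection \<open>Operators\<close>

text \<open>
  An operator \<open>X \<rightarrow> Y\<close> is a total function of which only the restriction to \<open>X\<close> matters.
\<close>

definition linear_between ::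
  "('k \<Rightarrow> 'a::ab_group_add \<Rightarrow> 'a) \<Rightarrow> ('k \<Rightarrow> 'b::ab_group_add \<Rightarrow> 'b) \<Rightarrow>
   'a set \<Rightarrow> 'b set \<Rightarrow> ('a \<Rightarrow> 'b) \<Rightarrow> bool" where
  "linear_between smulX smulY X Y T \<longleftrightarrow>
     T ` X \<subseteq> Y \<and>
     (\<forall>x\<in>X. \<forall>y\<in>X. T (x + y) = T x + T y) \<and>
     (\<forall>c. \<forall>x\<in>X. T (smulX c x) = smulY c (T x))"

definition continuous_operator ::
  "('k \<Rightarrow> 'a::ab_group_add \<Rightarrow> 'a) \<Rightarrow> ('k \<Rightarrow> 'b::ab_group_add \<Rightarrow> 'b) \<Rightarrow>
   'a set \<Rightarrow> ('a \<Rightarrow> real) \<Rightarrow> 'b set \<Rightarrow> ('b \<Rightarrow> real) \<Rightarrow> ('a \<Rightarrow> 'b) \<Rightarrow> bool" where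
  "continuous_operator smulX smulY X NX Y NY T \<longleftrightarrow>
     linear_between smulX smulY X Y T \<and>
     continuous_map (norm_topology X NX) (norm_topology Y NY) T"

definition compact_operator ::
  "('k \<Rightarrow> 'a::ab_group_add \<Rightarrow> 'a) \<Rightarrow> ('k \<Rightarrow> 'b::ab_group_add \<Rightarrow> 'b) \<Rightarrow>
   'a set \<Rightarrow> ('a \<Rightarrow> real) \<Rightarrow> 'b set \<Rightarrow> ('b \<Rightarrow> real) \<Rightarrow> ('a \<Rightarrow> 'b) \<Rightarrow> bool" where
  "compact_operator smulX smulY X NX Y NY T \<longleftrightarrow>
     linear_between smulX smulY X Y T \<and>
     compactin (norm_topology Y NY)
       (norm_topology Y NY closure_of (T ` {x \<in> X. NX x \<le> 1}))"

definition invertible_operator ::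
  "('k \<Rightarrow> 'a::ab_group_add \<Rightarrow> 'a) \<Rightarrow> ('k \<Rightarrow> 'b::ab_group_add \<Rightarrow> 'b) \<Rightarrow>
   'a set \<Rightarrow> ('a \<Rightarrow> real) \<Rightarrow> 'b set \<Rightarrow> ('b \<Rightarrow> real) \<Rightarrow> ('a \<Rightarrow> 'b) \<Rightarrow> bool" where
  "invertible_operator smulX smulY X NX Y NY T \<longleftrightarrow>
     continuous_operator smulX smulY X NX Y NY T \<and>
     (\<exists>S. continuous_operator smulY smulX Y NY X NX S \<and>
          (\<forall>x\<in>X. S (T x) = x) \<and> (\<forall>y\<in>Y. T (S y) = y))"

definition kernel_on :: "'a set \<Rightarrow> ('a \<Rightarrow> 'b::zero) \<Rightarrow> 'a set" where
  "kernel_on X T = {x \<in> X. T x = 0}"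

subsection \<open>Dimension, codimension and index\<close>

definition finite_dim_subspace ::
  "('k::field \<Rightarrow> 'a::ab_group_add \<Rightarrow> 'a) \<Rightarrow> 'a set \<Rightarrow> bool" where
  "finite_dim_subspace smul V \<longleftrightarrow> (\<exists>B. finite B \<and> V = module.span smul B)"

definition is_direct_sum :: "'a::ab_group_add set \<Rightarrow> 'a set \<Rightarrow> 'a set \<Rightarrow> bool" where
  "is_direct_sum Y V W \<longleftrightarrow> Y = {v + w |v w. v \<in> V \<and> w \<in> W} \<and> V \<inter> W = {0}"

text \<open>
  \<open>quotient_basis smul Y W B\<close> says that the cosets \<open>b + W\<close>, for \<open>b \<in> B\<close>, are pairwise distinct and
  form a finite basis of the quotient space \<open>Y / W\<close>.
\<close>

definition quotient_basis ::
  "('k::field \<Rightarrow> 'a::ab_group_add \<Rightarrow> 'a) \<Rightarrow> 'a set \<Rightarrow> 'a set \<Rightarrow> 'a set \<Rightarrow> bool" where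
  "quotient_basis smul Y W B \<longleftrightarrow>
     finite B \<and> B \<subseteq> Y \<and>
     (\<forall>y\<in>Y. \<exists>c. y - (\<Sum>b\<in>B. smul (c b) b) \<in> W) \<and>
     (\<forall>c. (\<Sum>b\<in>B. smul (c b) b) \<in> W \<longrightarrow> (\<forall>b\<in>B. c b = 0))"

definition codim ::
  "('k::field \<Rightarrow> 'a::ab_group_add \<Rightarrow> 'a) \<Rightarrow> 'a set \<Rightarrow> 'a set \<Rightarrow> nat" where
  "codim smul Y W = card (SOME B. quotient_basis smul Y W B)"

text \<open>
  No closedness of the range is required in the next definition: for a continuous operator between
  Banach spaces it follows from the finite codimension.
\<close>

definition fredholm_operator ::
  "('k::real_normed_field \<Rightarrow> 'a::ab_group_add \<Rightarrow> 'a) \<Rightarrow>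
   ('k \<Rightarrow> 'b::ab_group_add \<Rightarrow> 'b) \<Rightarrow>
   'a set \<Rightarrow> ('a \<Rightarrow> real) \<Rightarrow> 'b set \<Rightarrow> ('b \<Rightarrow> real) \<Rightarrow> ('a \<Rightarrow> 'b) \<Rightarrow> bool" where
  "fredholm_operator smulX smulY X NX Y NY T \<longleftrightarrow>
     continuous_operator smulX smulY X NX Y NY T \<and>
     finite_dim_subspace smulX (kernel_on X T) \<and>
     (\<exists>B. quotient_basis smulY Y (T ` X) B)"

definition index_of ::
  "('k::field \<Rightarrow> 'a::ab_group_add \<Rightarrow> 'a) \<Rightarrow> ('k \<Rightarrow> 'b::ab_group_add \<Rightarrow> 'b) \<Rightarrow>
   'a set \<Rightarrow> 'b set \<Rightarrow> ('a \<Rightarrow> 'b) \<Rightarrow> int" where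
  "index_of smulX smulY X Y T =
     int (vector_space.dim smulX (kernel_on X T)) - int (codim smulY Y (T ` X))"

subsection \<open>Families of Banach spaces\<close>

definition H_infinity :: "'s set \<Rightarrow> ('s \<Rightarrow> 'a set) \<Rightarrow> 'a set" where
  "H_infinity \<Sigma> H = (\<Inter>s\<in>\<Sigma>. H s)"

definition admissible_family ::
  "('k::real_normed_field \<Rightarrow> 'a::ab_group_add \<Rightarrow> 'a) \<Rightarrow>
   's set \<Rightarrow> ('s \<Rightarrow> 'a set) \<Rightarrow> ('s \<Rightarrow> 'a \<Rightarrow> real) \<Rightarrow> bool" where
  "admissible_family smul \<Sigma> H N \<longleftrightarrow>
     vector_space smul \<and>
     (\<forall>s\<in>\<Sigma>.
        banach_on smul (H s) (N s) \<and>
        norm_topology (H s) (N s) closure_of H_infinity \<Sigma> H = H s \<and>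
        (\<forall>T. continuous_operator smul smul (H s) (N s) (H s) (N s) T \<and>
             T ` H s \<subseteq> H_infinity \<Sigma> H \<longrightarrow>
             compact_operator smul smul (H s) (N s) (H s) (N s) T))"

text \<open>
  \<open>Ts\<close> is the family of continuous extensions of \<open>T\<close>, which is unique on each \<open>H s\<close> because
  \<open>H_infinity\<close> is dense.
\<close>

definition continuous_extensions ::
  "('k \<Rightarrow> 'a::ab_group_add \<Rightarrow> 'a) \<Rightarrow> ('k \<Rightarrow> 'b::ab_group_add \<Rightarrow> 'b) \<Rightarrow> 's set \<Rightarrow>
   ('s \<Rightarrow> 'a set) \<Rightarrow> ('s \<Rightarrow> 'a \<Rightarrow> real) \<Rightarrow> ('s \<Rightarrow> 'b set) \<Rightarrow> ('s \<Rightarrow> 'b \<Rightarrow> real) \<Rightarrow>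
   ('a \<Rightarrow> 'b) \<Rightarrow> ('s \<Rightarrow> 'a \<Rightarrow> 'b) \<Rightarrow> bool" where
  "continuous_extensions smulX smulY \<Sigma> H N K M T Ts \<longleftrightarrow>
     (\<forall>s\<in>\<Sigma>. continuous_operator smulX smulY (H s) (N s) (K s) (M s) (Ts s) \<and>
             (\<forall>x \<in> H_infinity \<Sigma> H. Ts s x = T x))"

definition regularizing ::
  "('k \<Rightarrow> 'a::ab_group_add \<Rightarrow> 'a) \<Rightarrow> 's set \<Rightarrow>
   ('s \<Rightarrow> 'a set) \<Rightarrow> ('s \<Rightarrow> 'a \<Rightarrow> real) \<Rightarrow> ('a \<Rightarrow> 'a) \<Rightarrow> bool" where
  "regularizing smul \<Sigma> H N C \<longleftrightarrow>
     (\<exists>Cs. continuous_extensions smul smul \<Sigma> H N H N C Cs \<and>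
           (\<forall>s\<in>\<Sigma>. Cs s ` H s \<subseteq> H_infinity \<Sigma> H))"

end

theory Submission
  imports Defs
begin

text \<open>
  Everything rests on the two identities \<open>1 - A1s A0s = C\<close> on \<open>H0 s\<close> and \<open>1 - A0s A1s = D\<close> on \<open>H1 s\<close>, which
  follow from the definition of the remainders by density of \<open>H_infinity\<close> (\<open>regularizing_extension\<close>).
  The operators \<open>C\<close> and \<open>D\<close> have their ranges in \<open>H_infinity\<close>, and this is used in two ways.

  Algebraically, it removes the dependence on \<open>s\<close>. An \<open>x\<close> with \<open>A0s x\<close> in \<open>H_infinity\<close> equals
  \<open>A1s (A0s x) + C x\<close> and so lies in \<open>H_infinity\<close> itself (\<open>regularity\<close>). Hence the kernel of \<open>A0s\<close> is the
  kernel of \<open>A0\<close>, and the range of \<open>A0s\<close> meets \<open>H_infinity\<close> exactly in the range of \<open>A0\<close>. Since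
  \<open>y = A0s (A1s y) + D y\<close>, the space \<open>H1 s\<close> is the sum of \<open>H_infinity\<close> and the range of \<open>A0s\<close>. Therefore the
  cokernel of \<open>A0s\<close> is canonically the quotient of \<open>H_infinity\<close> by the range of \<open>A0\<close>, and a basis of
  this quotient serves all \<open>s\<close> at once (\<open>quotient_basis_transfer\<close>). Its span is \<open>V\<^sub>1\<close>.

  Analytically, it makes \<open>C\<close> and \<open>D\<close> compact by the assumption on the families, which makes kernel and cokernel finite-dimensional. This is
  Riesz theory, in the following form. A subspace \<open>Y\<close> has a finite-dimensional quotient by a closed
  subspace \<open>W\<close> as soon as the elements of its unit ball are congruent modulo \<open>W\<close> to elements of a
  totally bounded set (\<open>finite_codim_if_totally_bounded\<close>). For the kernel, \<open>W = {0}\<close> and \<open>C\<close> is the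
  identity on it. For the cokernel, \<open>W\<close> is the range of \<open>A0s\<close> and \<open>y - D y\<close> lies in \<open>W\<close>. The range is closed
  because \<open>A0s\<close> is bounded below modulo its kernel (\<open>dist_kernel_le\<close>). The same bound makes the inverse
  of a bijective \<open>A0s\<close> continuous, and bijectivity means \<open>V\<^sub>0 = V\<^sub>1 = {0}\<close>, a condition without \<open>s\<close>.
\<close>

section \<open>Bases of quotient spaces\<close>

context vector_space
begin

lemma quotient_basisD:
  assumes "quotient_basis scale Y W B"
  shows "finite B" "B \<subseteq> Y"
    and "y \<in> Y \<Longrightarrow> \<exists>c. y - (\<Sum>b\<in>B. scale (c b) b) \<in> W"
    and "(\<Sum>b\<in>B. scale (c b) b) \<in> W \<Longrightarrow> b \<in> B \<Longrightarrow> c b = 0"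
  using assms unfolding quotient_basis_def by simp_all

text \<open>
  A spanning set of \<open>Y / W\<close> that is linearly dependent modulo \<open>W\<close> contains a redundant element,
  so discarding elements ends in a basis.
\<close>

lemma quotient_basis_exists:
  assumes "finite F" "F \<subseteq> Y" "subspace W" "\<And>y. y \<in> Y \<Longrightarrow> \<exists>v\<in>span F. y - v \<in> W"
  shows "\<exists>B. quotient_basis scale Y W B"
  using assms(1,2,4)
proof (induction F rule: finite_psubset_induct)
  case (psubset F)
  show ?case
  proof (cases "\<forall>c. (\<Sum>b\<in>F. scale (c b) b) \<in> W \<longrightarrow> (\<forall>b\<in>F. c b = 0)")
    case True
    have "\<exists>c. y - (\<Sum>b\<in>F. scale (c b) b) \<in> W" if "y \<in> Y" for y
      using psubset.prems(2)[OF that] span_finite[OF psubset.hyps(1)] by auto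
    then have "quotient_basis scale Y W F"
      unfolding quotient_basis_def using True psubset by blast
    then show ?thesis ..
  next
    case False
    then obtain c a where c: "(\<Sum>b\<in>F. scale (c b) b) \<in> W" and a: "a \<in> F" "c a \<noteq> 0"
      by blast
    define g where "g = (\<Sum>b\<in>F-{a}. scale (c b) b)"
    have g: "g \<in> span (F - {a})"
      unfolding g_def by (intro span_sum span_scale span_base)
    have sum: "(\<Sum>b\<in>F. scale (c b) b) = scale (c a) a + g"
      unfolding g_def using a psubset.hyps by (simp add: sum.remove)
    have "\<exists>v\<in>span (F - {a}). y - v \<in> W" if y: "y \<in> Y" for y
    proof -
      obtain v where v: "v \<in> span F" "y - v \<in> W"
        using psubset.prems(2)[OF y] by blast
      obtain k where k: "v - scale k a \<in> span (F - {a})"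
        using span_breakdown[OF a(1) v(1)] by blast
      let ?v = "v - scale k a - scale (k / c a) g"
      have "y - ?v = (y - v) + scale (k / c a) (scale (c a) a + g)"
        using a(2) by (simp add: scale_right_distrib)
      also have "\<dots> \<in> W"
        using v(2) c sum by (metis subspace_add subspace_scale assms(3))
      finally show ?thesis
        using k g by (blast intro: span_diff span_scale)
    qed
    then show ?thesis
      using psubset.IH[of "F - {a}"] psubset.prems a by blast
  qed
qed

lemma independent_quotient_basis:
  assumes "quotient_basis scale Y W B" "subspace W"
  shows "independent B"
  using independent_if_scalars_zero[OF quotient_basisD(1)[OF assms(1)]]
    quotient_basisD(4)[OF assms(1)] subspace_0[OF assms(2)] by simp

lemma is_direct_sum_span_quotient_basis:
  assumes B: "quotient_basis scale Y W B" and W: "subspace W" "W \<subseteq> Y" and Y: "subspace Y"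
  shows "is_direct_sum Y (span B) W"
proof -
  note fin = quotient_basisD(1)[OF B] and decomp = quotient_basisD(3)[OF B]
    and zero = quotient_basisD(4)[OF B]
  have sub: "span B \<subseteq> Y"
    using quotient_basisD(2)[OF B] Y by (rule span_minimal)
  have "\<exists>v w. y = v + w \<and> v \<in> span B \<and> w \<in> W" if y: "y \<in> Y" for y
  proof -
    obtain c where "y - (\<Sum>b\<in>B. scale (c b) b) \<in> W"
      using decomp[OF y] by blast
    moreover have "(\<Sum>b\<in>B. scale (c b) b) \<in> span B"
      by (intro span_sum span_scale span_base)
    ultimately show ?thesis
      by (metis add.commute diff_add_cancel)
  qed
  moreover have "v + w \<in> Y" if "v \<in> span B" "w \<in> W" for v w
    using that sub W Y by (blast intro: subspace_add)
  ultimately have "Y = {v + w |v w. v \<in> span B \<and> w \<in> W}"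
    by blast
  moreover have "v = 0" if v: "v \<in> span B" "v \<in> W" for v
  proof -
    obtain c where c: "v = (\<Sum>b\<in>B. scale (c b) b)"
      using v(1) span_finite[OF fin] by auto
    then have "\<forall>b\<in>B. scale (c b) b = 0"
      using zero[OF v(2)[unfolded c]] by (metis scale_zero_left)
    then show ?thesis
      unfolding c by (rule sum.neutral)
  qed
  ultimately show ?thesis
    unfolding is_direct_sum_def using W by (auto simp: span_zero subspace_0)
qed

text \<open>
  The elements of one quotient basis are congruent modulo \<open>W\<close> to linear combinations of the other,
  and these representatives remain linearly independent.
\<close>

lemma card_quotient_basis_le:
  assumes B: "quotient_basis scale Y W B" and B': "quotient_basis scale Y W B'"
    and W: "subspace W"
  shows "card B \<le> card B'"
proof -
  note fin = quotient_basisD(1)[OF B] quotient_basisD(1)[OF B']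
    and decomp = quotient_basisD(3)[OF B'] and zero = quotient_basisD(4)[OF B]
  have "\<exists>v\<in>span B'. b - v \<in> W" if "b \<in> B" for b
  proof -
    have "b \<in> Y"
      using that quotient_basisD(2)[OF B] by blast
    then obtain c where "b - (\<Sum>v\<in>B'. scale (c v) v) \<in> W"
      using decomp by blast
    moreover have "(\<Sum>v\<in>B'. scale (c v) v) \<in> span B'"
      by (intro span_sum span_scale span_base)
    ultimately show ?thesis ..
  qed
  then obtain g where g: "\<And>b. b \<in> B \<Longrightarrow> g b \<in> span B'" "\<And>b. b \<in> B \<Longrightarrow> b - g b \<in> W"
    by metis
  have g_zero: "c b = 0" if "(\<Sum>b\<in>B. scale (c b) (g b)) = 0" "b \<in> B" for c b
  proof (rule zero[OF _ that(2)])
    have "(\<Sum>b\<in>B. scale (c b) b) = (\<Sum>b\<in>B. scale (c b) (b - g b))"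
      using that(1) by (simp add: scale_right_diff_distrib sum_subtractf)
    also have "\<dots> \<in> W"
      by (intro subspace_sum subspace_scale W g(2))
    finally show "(\<Sum>b\<in>B. scale (c b) b) \<in> W" .
  qed
  have inj: "inj_on g B"
  proof (rule inj_onI, rule ccontr)
    fix a b assume ab: "a \<in> B" "b \<in> B" "g a = g b" "a \<noteq> b"
    let ?c = "\<lambda>x. if x = a then 1 else if x = b then - 1 else 0"
    have "(\<Sum>x\<in>B. scale (?c x) (g x)) = (\<Sum>x\<in>{a, b}. scale (?c x) (g x))"
      using ab fin by (intro sum.mono_neutral_right) auto
    also have "\<dots> = 0"
      using ab by simp
    finally show False
      using g_zero[of ?c a] ab by auto
  qed
  have "independent (g ` B)"
  proof (rule independent_if_scalars_zero)
    fix u x assume "(\<Sum>x\<in>g ` B. scale (u x) x) = 0" "x \<in> g ` B"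
    then show "u x = 0"
      using g_zero[of "\<lambda>b. u (g b)"] inj by (auto simp: sum.reindex)
  qed (use fin in simp)
  then have "card (g ` B) \<le> card B'"
    using independent_span_bound[OF fin(2)] g(1) by blast
  then show ?thesis
    using inj by (simp add: card_image)
qed

lemma codim_eq_card:
  assumes "quotient_basis scale Y W B" "subspace W"
  shows "codim scale Y W = card B"
  unfolding codim_def
  by (metis assms card_quotient_basis_le le_antisym someI_ex)

end

section \<open>Closed subspaces of a normed space\<close>

locale normed_subspace =
  fixes smul :: "'k::{real_normed_field, heine_borel} \<Rightarrow> 'a::ab_group_add \<Rightarrow> 'a"
    and X :: "'a set" and N :: "'a \<Rightarrow> real"
  assumes normed: "normed_on smul X N"

sublocale normed_subspace \<subseteq> vector_space smul
  using normed unfolding normed_on_def by blast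

sublocale normed_subspace \<subseteq> Metric_space X "norm_dist X N"
  by (rule Metric_space_norm_dist[OF normed])

context normed_subspace
begin

lemma subspace_X: "subspace X"
  using normed unfolding normed_on_def by blast

lemma norm_nonneg: "x \<in> X \<Longrightarrow> 0 \<le> N x"
  and norm_eq_0: "x \<in> X \<Longrightarrow> N x = 0 \<longleftrightarrow> x = 0"
  and norm_smul: "x \<in> X \<Longrightarrow> N (smul c x) = norm c * N x"
  and norm_triangle: "x \<in> X \<Longrightarrow> y \<in> X \<Longrightarrow> N (x + y) \<le> N x + N y"
  using normed unfolding normed_on_def by simp_all

lemmas X_zero = subspace_0[OF subspace_X]
  and X_add = subspace_add[OF subspace_X]
  and X_diff = subspace_diff[OF subspace_X]
  and X_smul = subspace_scale[OF subspace_X]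

lemma norm_zero: "N 0 = 0"
  using norm_eq_0 X_zero by blast

lemma norm_minus_commute: "x \<in> X \<Longrightarrow> y \<in> X \<Longrightarrow> N (x - y) = N (y - x)"
  using norm_smul[of "x - y" "- 1"] X_diff by simp

lemma norm_triangle_diff: "x \<in> X \<Longrightarrow> y \<in> X \<Longrightarrow> N (x - y) \<le> N x + N y"
  using norm_triangle[of x "- y"] norm_smul[of y "- 1"] subspace_neg[OF subspace_X, of y] by simp

abbreviation converges :: "(nat \<Rightarrow> 'a) \<Rightarrow> 'a \<Rightarrow> bool" where
  "converges f l \<equiv> (\<lambda>n. N (f n - l)) \<longlonglongrightarrow> 0"

lemma limitin_iff_converges:
  assumes "\<And>n. f n \<in> X"
  shows "limitin mtopology f l sequentially \<longleftrightarrow> l \<in> X \<and> converges f l"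
  by (cases "l \<in> X") (simp_all add: limitin_metric_dist_null norm_dist_def assms)

lemma converges_unique:
  assumes "\<And>n. f n \<in> X" "l \<in> X" "l' \<in> X" "converges f l" "converges f l'"
  shows "l = l'"
proof (rule limitin_metric_unique)
  show "limitin mtopology f l sequentially" "limitin mtopology f l' sequentially"
    using assms(2-5) by (simp_all add: limitin_iff_converges[OF assms(1)])
qed simp

lemma converges_subseq: "strict_mono (r :: nat \<Rightarrow> nat) \<Longrightarrow> converges f l \<Longrightarrow> converges (f \<circ> r) l"
  using LIMSEQ_subseq_LIMSEQ[of "\<lambda>n. N (f n - l)" 0 r] by (simp add: comp_def)

lemma converges_bound:
  assumes "\<And>n. f n \<in> X" "l \<in> X" "\<And>n. N (f n - l) \<le> e n" "e \<longlonglongrightarrow> 0"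
  shows "converges f l"
proof (rule tendsto_sandwich[OF _ _ tendsto_const assms(4)])
  show "\<forall>\<^sub>F n in sequentially. 0 \<le> N (f n - l)"
    by (intro always_eventually allI norm_nonneg X_diff assms(1,2))
  show "\<forall>\<^sub>F n in sequentially. N (f n - l) \<le> e n"
    by (intro always_eventually allI assms(3))
qed

lemma converges_add:
  assumes "\<And>n. f n \<in> X" "\<And>n. g n \<in> X" "l \<in> X" "m \<in> X" "converges f l" "converges g m"
  shows "converges (\<lambda>n. f n + g n) (l + m)"
proof (rule converges_bound)
  show "N (f n + g n - (l + m)) \<le> N (f n - l) + N (g n - m)" for n
    using norm_triangle[of "f n - l" "g n - m"] assms(1-4) X_diff
    by (simp add: algebra_simps)
  show "(\<lambda>n. N (f n - l) + N (g n - m)) \<longlonglongrightarrow> 0"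
    using tendsto_add[OF assms(5,6)] by simp
qed (use assms X_add in auto)

lemma converges_diff:
  assumes "\<And>n. f n \<in> X" "\<And>n. g n \<in> X" "l \<in> X" "m \<in> X" "converges f l" "converges g m"
  shows "converges (\<lambda>n. f n - g n) (l - m)"
proof (rule converges_bound)
  show "N (f n - g n - (l - m)) \<le> N (f n - l) + N (g n - m)" for n
    using norm_triangle_diff[of "f n - l" "g n - m"] assms(1-4) X_diff
    by (simp add: algebra_simps)
  show "(\<lambda>n. N (f n - l) + N (g n - m)) \<longlonglongrightarrow> 0"
    using tendsto_add[OF assms(5,6)] by simp
qed (use assms X_diff in auto)

lemma converges_smul:
  assumes "v \<in> X" "k \<longlonglongrightarrow> c"
  shows "converges (\<lambda>n. smul (k n) v) (smul c v)"
proof (rule converges_bound)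
  show "N (smul (k n) v - smul c v) \<le> norm (k n - c) * N v" for n
    using norm_smul[OF assms(1), of "k n - c"] by (simp add: scale_left_diff_distrib)
  show "(\<lambda>n. norm (k n - c) * N v) \<longlonglongrightarrow> 0"
    using assms(2) LIM_zero tendsto_norm_zero tendsto_mult_left_zero by blast
qed (use assms X_smul in auto)

lemma in_closure_converges:
  assumes "x \<in> mtopology closure_of S"
  obtains f where "\<And>n. f n \<in> S \<inter> X" "x \<in> X" "converges f x"
  using assms limitin_iff_converges unfolding closure_of_sequentially
  by (auto simp: image_subset_iff) blast

lemma closedin_if_converges:
  assumes "S \<subseteq> X" "\<And>f x. (\<And>n. f n \<in> S) \<Longrightarrow> x \<in> X \<Longrightarrow> converges f x \<Longrightarrow> x \<in> S"
  shows "closedin mtopology S"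
proof -
  have "mtopology closure_of S \<subseteq> S"
    using assms(2) by (metis IntD1 in_closure_converges subsetI)
  then show ?thesis
    using assms(1) closure_of_subset[of S mtopology] closure_of_eq by fastforce
qed

lemma closedin_converges:
  assumes "closedin mtopology S" "\<And>n. f n \<in> S" "x \<in> X" "converges f x"
  shows "x \<in> S"
proof -
  have X: "f n \<in> X" for n
    using assms(1,2) closedin_metric by blast
  have "limitin mtopology f x sequentially"
    using X assms(3,4) limitin_iff_converges[of f x] by simp
  then show ?thesis
    by (rule limitin_closedin) (simp_all add: assms(1,2))
qed

lemma dist_closedin_pos:
  assumes "closedin mtopology S" "x \<in> X" "x \<notin> S"
  obtains d where "0 < d" "\<And>w. w \<in> S \<Longrightarrow> d \<le> N (x - w)"
proof -
  have "x \<notin> mtopology closure_of S" and S: "S \<subseteq> X"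
    using assms closure_of_closedin closedin_metric by auto
  then obtain r where r: "0 < r" "\<And>y. y \<in> S \<Longrightarrow> y \<notin> mball x r"
    using assms(2) unfolding metric_closure_of by blast
  have "r \<le> N (x - w)" if "w \<in> S" for w
    using r(2)[OF that] that S assms(2) by (auto simp: norm_dist_def not_less)
  then show ?thesis
    using that r(1) by blast
qed

lemma closedin_zero: "closedin mtopology {0}"
  by (rule closedin_Hausdorff_singleton) (auto simp: Hausdorff_space_mtopology X_zero)

text \<open>
  If \<open>v \<notin> W\<close> and \<open>w\<^sub>n + k\<^sub>n v\<close> converges with \<open>w\<^sub>n \<in> W\<close>, then the coefficients \<open>k\<^sub>n\<close> form a Cauchy sequence, because
  \<open>v\<close> has a positive distance from \<open>W\<close>. Their limit exists, as the scalars are complete.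
\<close>

lemma closedin_span_insert:
  assumes W: "closedin mtopology W" "subspace W" and v: "v \<in> X"
  shows "closedin mtopology (span (insert v W))"
proof -
  have span_W: "span W = W"
    using W(2) by (simp add: span_eq_iff)
  show ?thesis
  proof (cases "v \<in> W")
    case True
    then show ?thesis
      using W(1) by (simp add: insert_absorb span_W)
  next
    case False
    obtain d where d: "0 < d" "\<And>w. w \<in> W \<Longrightarrow> d \<le> N (v - w)"
      using dist_closedin_pos[OF W(1) v False] by blast
    have WX: "W \<subseteq> X"
      using W(1) closedin_metric by blast
    then have ZX: "span (insert v W) \<subseteq> X"
      using v by (intro span_minimal subspace_X) auto
    have coeff: "norm c * d \<le> N (smul c v - w)" if "w \<in> W" for c w
    proof (cases "c = 0")
      case False
      have "smul c v - w = smul c (v - smul (1 / c) w)"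
        using False by (simp add: scale_right_diff_distrib)
      moreover have "d \<le> N (v - smul (1 / c) w)"
        using d(2) that W(2) subspace_scale by blast
      moreover have "v - smul (1 / c) w \<in> X"
        using v that WX X_diff X_smul by blast
      ultimately show ?thesis
        by (simp add: norm_smul mult_left_mono)
    next
      case True
      have "0 - w \<in> X"
        using that WX by (intro X_diff X_zero) blast
      then show ?thesis
        using True norm_nonneg by simp
    qed
    show ?thesis
    proof (rule closedin_if_converges[OF ZX])
      fix f x assume f: "\<And>n. f n \<in> span (insert v W)" and x: "x \<in> X" and lim: "converges f x"
      have fX: "f n \<in> X" for n
        using f ZX by blast
      have "\<exists>k. f n - smul k v \<in> W" for n
        using f[of n] unfolding span_insert span_W by simp
      then obtain k where k: "\<And>n. f n - smul (k n) v \<in> W"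
        by metis
      have diff: "norm (k m - k n) * d \<le> N (f m - x) + N (f n - x)" for m n
      proof -
        have "(f n - smul (k n) v) - (f m - smul (k m) v) \<in> W"
          using k W(2) subspace_diff by blast
        then have "norm (k m - k n) * d
            \<le> N (smul (k m - k n) v - ((f n - smul (k n) v) - (f m - smul (k m) v)))"
          by (rule coeff)
        also have "smul (k m - k n) v - ((f n - smul (k n) v) - (f m - smul (k m) v))
            = (f m - x) - (f n - x)"
          by (simp add: scale_left_diff_distrib)
        also have "N \<dots> \<le> N (f m - x) + N (f n - x)"
          using fX x X_diff norm_triangle_diff by blast
        finally show ?thesis .
      qed
      have "Cauchy k"
      proof (rule CauchyI)
        fix e :: real assume "0 < e"
        then have "0 < e * d / 2"
          using d(1) by simp
        then obtain M where M: "\<And>n. n \<ge> M \<Longrightarrow> N (f n - x) < e * d / 2"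
          using LIMSEQ_D[OF lim] by fastforce
        have "norm (k m - k n) < e" if "m \<ge> M" "n \<ge> M" for m n
        proof -
          have "norm (k m - k n) * d < e * d"
            using diff[of m n] M[OF that(1)] M[OF that(2)] by linarith
          then show ?thesis
            using d(1) by simp
        qed
        then show "\<exists>M. \<forall>m\<ge>M. \<forall>n\<ge>M. norm (k m - k n) < e"
          by blast
      qed
      then obtain c where c: "k \<longlonglongrightarrow> c"
        using Cauchy_convergent convergent_def by blast
      have "converges (\<lambda>n. f n - smul (k n) v) (x - smul c v)"
        by (intro converges_diff converges_smul fX x X_smul v lim c)
      then have "x - smul c v \<in> W"
        by (intro closedin_converges[OF W(1) k] X_diff x X_smul v)
      then show "x \<in> span (insert v W)"
        unfolding span_insert span_W by blast
    qed
  qed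
qed

lemma closedin_span_Un_finite:
  assumes "finite F" "F \<subseteq> X" "closedin mtopology W" "subspace W"
  shows "closedin mtopology (span (F \<union> W))"
  using assms(1,2)
proof induction
  case empty
  then show ?case
    using assms(3) by (simp add: span_eq_iff[THEN iffD2, OF assms(4)])
next
  case (insert v F)
  have "span (insert v (F \<union> W)) = span (insert v (span (F \<union> W)))"
    unfolding span_insert span_span ..
  then show ?case
    using insert closedin_span_insert[of "span (F \<union> W)" v] by (simp add: subspace_span)
qed

text \<open>
  Riesz's lemma, before normalisation: \<open>k\<close> is a best approximation of \<open>x\<close> in \<open>W\<close> up to a factor 2.
\<close>

lemma almost_best_approximation:
  assumes W: "closedin mtopology W" "subspace W" and x: "x \<in> X" "x \<notin> W"
  obtains k where "k \<in> W" "0 < N (x - k)" "\<And>w. w \<in> W \<Longrightarrow> N (x - k) \<le> 2 * N (x - k - w)"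
proof -
  obtain d where d: "0 < d" "\<And>w. w \<in> W \<Longrightarrow> d \<le> N (x - w)"
    using dist_closedin_pos[OF W(1) x] by blast
  let ?D = "(\<lambda>w. N (x - w)) ` W"
  have ne: "?D \<noteq> {}"
    using subspace_0[OF W(2)] by blast
  have bdd: "bdd_below ?D"
    using d(2) by (rule bdd_belowI2)
  have "d \<le> Inf ?D"
    using ne d(2) by (auto intro: cInf_greatest)
  then have "Inf ?D < 2 * Inf ?D"
    using d(1) by linarith
  then obtain k where k: "k \<in> W" "N (x - k) < 2 * Inf ?D"
    using cInf_lessD[OF ne] by blast
  have "N (x - k) \<le> 2 * N (x - k - w)" if "w \<in> W" for w
  proof -
    have "k + w \<in> W"
      using W(2) k that subspace_add by blast
    then have "Inf ?D \<le> N (x - (k + w))"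
      using bdd by (intro cInf_lower) auto
    then show ?thesis
      using k(2) by (simp add: diff_diff_eq)
  qed
  then show ?thesis
    using that k(1) d by force
qed

text \<open>
  The quotient version of Riesz's theorem on locally compact normed spaces. Let \<open>Z\<close> be the span of \<open>W\<close>
  and of a finite \<open>1/4\<close>-net for the unit ball of \<open>Y\<close> modulo \<open>W\<close>. Every \<open>y \<in> Y\<close> is within \<open>N y / 4\<close> of \<open>Z\<close>, and
  applied to the error of an almost best approximation this leaves no room for an element outside
  the closed subspace \<open>Z\<close>.
\<close>

lemma finite_codim_if_totally_bounded:
  assumes W: "closedin mtopology W" "subspace W" "W \<subseteq> Y"
    and Y: "subspace Y" "Y \<subseteq> X"
    and S: "mtotally_bounded S"
    and cong: "\<And>y. y \<in> Y \<Longrightarrow> N y \<le> 1 \<Longrightarrow> \<exists>s\<in>S \<inter> Y. y - s \<in> W"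
  shows "\<exists>F. finite F \<and> F \<subseteq> Y \<and> (\<forall>y\<in>Y. \<exists>v\<in>span F. y - v \<in> W)"
proof -
  have "mtotally_bounded (S \<inter> Y)"
    using S mtotally_bounded_subset by blast
  then obtain F where F: "finite F" "F \<subseteq> S \<inter> Y" "S \<inter> Y \<subseteq> (\<Union>x\<in>F. mball x (1/4))"
    unfolding mtotally_bounded_def by (meson zero_less_divide_1_iff zero_less_numeral)
  let ?Z = "span (F \<union> W)"
  have Z: "closedin mtopology ?Z"
    using closedin_span_Un_finite F Y W by blast
  have ZY: "?Z \<subseteq> Y"
    using F W Y by (intro span_minimal) auto
  have quarter: "\<exists>z\<in>?Z. N (y - z) \<le> N y / 4" if y: "y \<in> Y" "0 < N y" for y
  proof -
    define r where "r = (of_real (N y) :: 'k)"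
    define u where "u = smul (inverse r) y"
    have r: "r \<noteq> 0" "norm r = N y"
      using y(2) unfolding r_def by auto
    then have y_eq: "y = smul r u"
      unfolding u_def by simp
    have u: "u \<in> Y"
      unfolding u_def using y(1) Y(1) subspace_scale by blast
    have "N u = 1"
      unfolding u_def using y Y(2) r by (subst norm_smul) (auto simp: norm_inverse)
    then obtain s where s: "s \<in> S" "s \<in> Y" "u - s \<in> W"
      using cong[OF u] by auto
    then obtain f where f: "f \<in> F" "s \<in> mball f (1/4)"
      using F by auto
    have X: "f \<in> X" "s \<in> X" "u \<in> X"
      using f s u F Y by auto
    let ?z = "f + (u - s)"
    have z: "?z \<in> ?Z"
      using f s by (intro span_add) (auto intro: span_base)
    have "N (y - smul r ?z) = N (smul r (s - f))"
      unfolding y_eq by (simp add: scale_right_distrib scale_right_diff_distrib)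
    also have "\<dots> = N y * N (s - f)"
      using X X_diff r(2) by (simp add: norm_smul)
    also have "\<dots> \<le> N y / 4"
      using f(2) X y(2) by (simp add: norm_dist_def norm_minus_commute)
    finally show ?thesis
      using z span_scale by blast
  qed
  have span_W: "span W = W"
    using W(2) by (simp add: span_eq_iff)
  have "y \<in> ?Z" if y: "y \<in> Y" for y
  proof (rule ccontr)
    assume "y \<notin> ?Z"
    then obtain k where k: "k \<in> ?Z" "0 < N (y - k)"
      "\<And>z. z \<in> ?Z \<Longrightarrow> N (y - k) \<le> 2 * N (y - k - z)"
      using almost_best_approximation[OF Z subspace_span] y Y by blast
    moreover have "y - k \<in> Y"
      using y k(1) ZY Y subspace_diff by blast
    ultimately show False
      using quarter[of "y - k"] by force
  qed
  then have "\<exists>v\<in>span F. y - v \<in> W" if "y \<in> Y" for y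
    using that span_W unfolding span_Un by force
  then show ?thesis
    using F by blast
qed

end

section \<open>Operators with a left parametrix\<close>

lemma linear_between_zero:
  assumes "linear_between smulX smulY X Y T" "0 \<in> X"
  shows "T 0 = 0"
proof -
  have "T (0 + 0) = T 0 + T 0"
    using assms unfolding linear_between_def by blast
  then show ?thesis
    by simp
qed

lemma linear_between_diff:
  assumes "linear_between smulX smulY X Y T" "x - y \<in> X" "y \<in> X"
  shows "T (x - y) = T x - T y"
proof -
  have "T ((x - y) + y) = T (x - y) + T y"
    using assms unfolding linear_between_def by blast
  then show ?thesis
    by simp
qed

context normed_subspace
begin

lemma compact_operator_subseq:
  fixes f :: "nat \<Rightarrow> 'a"
  assumes T: "compact_operator smul smul X N X N T"
    and f: "\<And>n. f n \<in> X" "\<And>n. N (f n) \<le> R"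
  obtains l r where "l \<in> X" "strict_mono r" "converges (\<lambda>n. T (f (r n))) l"
proof -
  \<comment> \<open>Division by \<open>c\<close> moves the sequence into the unit ball; the maximum keeps \<open>c\<close> nonzero.\<close>
  define c :: 'k where "c = of_real (max R 1)"
  have c: "c \<noteq> 0" "norm c = max R 1"
    unfolding c_def by auto
  let ?U = "{x \<in> X. N x \<le> 1}"
  have lin: "linear_between smul smul X X T"
    and cpt: "compactin mtopology (mtopology closure_of (T ` ?U))"
    using T unfolding compact_operator_def by blast+
  define g where "g n = smul (inverse c) (f n)" for n
  have "N (g n) = N (f n) / max R 1" for n
    unfolding g_def using f(1) c by (simp add: norm_smul norm_inverse divide_inverse mult.commute)
  then have "N (g n) \<le> 1" for n
    using f(2)[of n] by simp
  then have g: "g n \<in> ?U" for n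
    unfolding g_def using f(1) X_smul by simp
  have TX: "T ` ?U \<subseteq> X"
    using lin unfolding linear_between_def by blast
  then have "T ` ?U \<subseteq> mtopology closure_of (T ` ?U)"
    by (intro closure_of_subset) simp
  then have "range (\<lambda>n. T (g n)) \<subseteq> mtopology closure_of (T ` ?U)"
    using g by blast
  then obtain l r where l: "strict_mono r" "limitin mtopology ((\<lambda>n. T (g n)) \<circ> r) l sequentially"
    using conjunct2[OF cpt[unfolded compactin_sequentially], rule_format, of "\<lambda>n. T (g n)"]
    by blast
  have TgX: "T (g n) \<in> X" for n
    using g TX by blast
  then have lX: "l \<in> X" and conv: "converges (\<lambda>n. T (g (r n))) l"
    using l(2) limitin_iff_converges[of "(\<lambda>n. T (g n)) \<circ> r" l] by simp_all
  have Tf: "T (f n) = smul c (T (g n))" for n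
  proof -
    have "f n = smul c (g n)"
      unfolding g_def using c by simp
    then show ?thesis
      using lin g unfolding linear_between_def by simp
  qed
  have "N (T (f (r n)) - smul c l) = norm c * N (T (g (r n)) - l)" for n
    unfolding Tf using TgX lX X_diff by (simp flip: norm_smul scale_right_diff_distrib)
  moreover have "(\<lambda>n. norm c * N (T (g (r n)) - l)) \<longlonglongrightarrow> 0"
    using tendsto_mult_right_zero[OF conv] by simp
  ultimately have "converges (\<lambda>n. T (f (r n))) (smul c l)"
    by simp
  then show ?thesis
    using that l(1) X_smul[OF lX] by blast
qed

lemma compact_operator_totally_bounded:
  assumes "compact_operator smul smul X N X N T"
  shows "mtotally_bounded (T ` {x \<in> X. N x \<le> 1})"
  using assms unfolding compact_operator_def linear_between_def
  by (intro compact_closure_of_imp_mtotally_bounded) auto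

end

locale normed_subspace_pair =
  X: normed_subspace smulX X NX + Y: normed_subspace smulY Y NY
  for smulX :: "'k::{real_normed_field, heine_borel} \<Rightarrow> 'a::ab_group_add \<Rightarrow> 'a" and X NX
    and smulY :: "'k \<Rightarrow> 'b::ab_group_add \<Rightarrow> 'b" and Y NY
begin

lemma continuous_operator_converges:
  assumes T: "continuous_operator smulX smulY X NX Y NY T"
    and f: "\<And>n. f n \<in> X" "x \<in> X" "X.converges f x"
  shows "Y.converges (\<lambda>n. T (f n)) (T x)"
proof -
  have "limitin X.mtopology f x sequentially"
    using f X.limitin_iff_converges[of f x] by simp
  then have "limitin Y.mtopology (T \<circ> f) (T x) sequentially"
    by (rule continuous_map_limit[OF conjunct2[OF T[unfolded continuous_operator_def]]])
  moreover have "T (f n) \<in> Y" for n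
    using T f(1) unfolding continuous_operator_def linear_between_def by blast
  ultimately show ?thesis
    using Y.limitin_iff_converges[of "T \<circ> f" "T x"] by simp
qed

lemma continuous_operator_if_bounded:
  assumes T: "linear_between smulX smulY X Y T"
    and bound: "\<And>x. x \<in> X \<Longrightarrow> NY (T x) \<le> c * NX x"
  shows "continuous_operator smulX smulY X NX Y NY T"
proof -
  have TY: "T x \<in> Y" if "x \<in> X" for x
    using T that unfolding linear_between_def by blast
  have "\<exists>d>0. \<forall>x. x \<in> X \<and> norm_dist X NX a x < d \<longrightarrow> norm_dist Y NY (T a) (T x) < e"
    if a: "a \<in> X" and e: "0 < e" for a e
  proof (intro exI[of _ "e / (\<bar>c\<bar> + 1)"] conjI allI impI)
    show "0 < e / (\<bar>c\<bar> + 1)"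
      using e by (simp add: add_nonneg_pos)
    fix x assume x: "x \<in> X \<and> norm_dist X NX a x < e / (\<bar>c\<bar> + 1)"
    have ax: "a - x \<in> X"
      using a x X.X_diff by blast
    have small: "NX (a - x) * (\<bar>c\<bar> + 1) < e"
      using conjunct1[OF x] conjunct2[OF x] a by (simp add: norm_dist_def pos_less_divide_eq add_nonneg_pos)
    have "NY (T a - T x) = NY (T (a - x))"
      using linear_between_diff[OF T ax] x by simp
    also have "\<dots> \<le> c * NX (a - x)"
      by (rule bound[OF ax])
    also have "\<dots> \<le> (\<bar>c\<bar> + 1) * NX (a - x)"
      using X.norm_nonneg[OF ax] by (intro mult_right_mono) auto
    also have "\<dots> < e"
      using small by (simp add: mult.commute)
    finally show "norm_dist Y NY (T a) (T x) < e"
      using a x TY by (simp add: norm_dist_def)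
  qed
  then have "continuous_map X.mtopology Y.mtopology T"
    unfolding X.metric_continuous_map[OF Y.Metric_space_axioms] using TY by blast
  then show ?thesis
    using T unfolding continuous_operator_def by blast
qed

end

text \<open>
  \<open>B\<close> inverts \<open>A\<close> from the left up to the compact error \<open>C\<close>. This controls the kernel and the closedness
  of the range, but not the size of the cokernel.
\<close>

locale left_parametrix = normed_subspace_pair smulX X NX smulY Y NY
  for smulX :: "'k::{real_normed_field, heine_borel} \<Rightarrow> 'a::ab_group_add \<Rightarrow> 'a" and X NX
    and smulY :: "'k \<Rightarrow> 'b::ab_group_add \<Rightarrow> 'b" and Y NY +
  fixes A :: "'a \<Rightarrow> 'b" and B :: "'b \<Rightarrow> 'a" and C :: "'a \<Rightarrow> 'a"
  assumes A: "continuous_operator smulX smulY X NX Y NY A"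
    and B: "continuous_operator smulY smulX Y NY X NX B"
    and C: "compact_operator smulX smulX X NX X NX C"
    and C_eq: "\<And>x. x \<in> X \<Longrightarrow> C x = x - B (A x)"
begin

lemma A_linear: "linear_between smulX smulY X Y A"
  and B_linear: "linear_between smulY smulX Y X B"
  using A B unfolding continuous_operator_def by simp_all

lemma A_in: "x \<in> X \<Longrightarrow> A x \<in> Y"
  and A_add: "x \<in> X \<Longrightarrow> x' \<in> X \<Longrightarrow> A (x + x') = A x + A x'"
  and A_smul: "x \<in> X \<Longrightarrow> A (smulX c x) = smulY c (A x)"
  using A_linear unfolding linear_between_def by blast+

lemma B_in: "y \<in> Y \<Longrightarrow> B y \<in> X"
  using B_linear unfolding linear_between_def by blast

lemma A_zero: "A 0 = 0" and B_zero: "B 0 = 0"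
  using linear_between_zero A_linear B_linear X.X_zero Y.X_zero by blast+

lemma A_diff: "x \<in> X \<Longrightarrow> x' \<in> X \<Longrightarrow> A (x - x') = A x - A x'"
  using linear_between_diff[OF A_linear] X.X_diff by blast

lemma C_on_kernel: "x \<in> kernel_on X A \<Longrightarrow> C x = x"
  using C_eq B_zero unfolding kernel_on_def by auto

lemma subspace_kernel: "X.subspace (kernel_on X A)"
  unfolding kernel_on_def
  by (rule X.subspaceI) (auto simp: X.X_zero X.X_add X.X_smul A_zero A_add A_smul)

lemma subspace_range: "Y.subspace (A ` X)"
proof (rule Y.subspaceI)
  show "0 \<in> A ` X"
    using A_zero X.X_zero by force
  show "y + y' \<in> A ` X" if "y \<in> A ` X" "y' \<in> A ` X" for y y'
    using that by (auto simp flip: A_add intro!: imageI X.X_add)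
  show "smulY c y \<in> A ` X" if "y \<in> A ` X" for c y
    using that by (auto simp flip: A_smul intro!: imageI X.X_smul)
qed

text \<open>
  The identity \<open>x = B (A x) + C x\<close> turns convergence of the images \<open>A x\<^sub>n\<close> into convergence of a
  subsequence of \<open>x\<^sub>n\<close>.
\<close>

lemma bounded_preimages_subseq:
  assumes x: "\<And>n. x n \<in> X" "\<And>n. NX (x n) \<le> R" and y: "y \<in> Y" "Y.converges (\<lambda>n. A (x n)) y"
  obtains l r where "l \<in> X" "strict_mono r" "X.converges (\<lambda>n. x (r n)) l" "A l = y"
proof -
  interpret YX: normed_subspace_pair smulY Y NY smulX X NX ..
  obtain m r where m: "m \<in> X" "strict_mono r" "X.converges (\<lambda>n. C (x (r n))) m"
    using X.compact_operator_subseq[OF C, of x R] x by blast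
  have Ax: "Y.converges (\<lambda>n. A (x (r n))) y"
    using Y.converges_subseq[OF m(2) y(2)] by (simp add: comp_def)
  then have "X.converges (\<lambda>n. B (A (x (r n)))) (B y)"
    using x(1) y(1) by (intro YX.continuous_operator_converges[OF B] A_in)
  then have "X.converges (\<lambda>n. B (A (x (r n))) + C (x (r n))) (B y + m)"
    using x(1) y(1) m X.X_diff C_eq A_in B_in by (intro X.converges_add) auto
  then have lim: "X.converges (\<lambda>n. x (r n)) (B y + m)"
    using x(1) C_eq by simp
  have l: "B y + m \<in> X"
    using y(1) m(1) B_in X.X_add by blast
  have "Y.converges (\<lambda>n. A (x (r n))) (A (B y + m))"
    using x(1) l lim by (rule continuous_operator_converges[OF A])
  then have "A (B y + m) = y"
    using Y.converges_unique[of "\<lambda>n. A (x (r n))"] Ax A_in x(1) l y(1) by blast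
  then show ?thesis
    using that l m(2) lim by blast
qed

lemma closedin_kernel: "closedin X.mtopology (kernel_on X A)"
proof (rule X.closedin_if_converges)
  fix f x assume f: "\<And>n. f n \<in> kernel_on X A" and x: "x \<in> X" "X.converges f x"
  have fX: "f n \<in> X" and f0: "A (f n) = 0" for n
    using f unfolding kernel_on_def by auto
  have "Y.converges (\<lambda>n. A (f n)) (A x)"
    using fX x by (rule continuous_operator_converges[OF A])
  moreover have "Y.converges (\<lambda>n. A (f n)) 0"
    unfolding f0 by (simp add: Y.norm_zero)
  ultimately have "A x = 0"
    using Y.converges_unique[of "\<lambda>n. A (f n)"] A_in fX x(1) Y.X_zero by blast
  then show "x \<in> kernel_on X A"
    using x(1) unfolding kernel_on_def by blast
qed (auto simp: kernel_on_def)

text \<open>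
  The induced map on \<open>X / ker A\<close> is bounded below. Otherwise there are almost best approximations
  by the kernel whose normalised errors \<open>z\<^sub>n\<close> satisfy \<open>A z\<^sub>n \<longlonglongrightarrow> 0\<close>; a limit point of the \<open>z\<^sub>n\<close> would lie
  in the kernel, although the \<open>z\<^sub>n\<close> keep distance \<open>1/2\<close> from it.
\<close>

lemma dist_kernel_le:
  "\<exists>c. \<forall>x\<in>X. \<exists>k\<in>kernel_on X A. NX (x - k) \<le> c * NY (A x)"
proof (rule ccontr)
  let ?K = "kernel_on X A"
  assume "\<not> ?thesis"
  then have "\<forall>n. \<exists>x\<in>X. \<forall>k\<in>?K. real n * NY (A x) < NX (x - k)"
    by (meson not_le)
  then obtain x where x: "\<And>n. x n \<in> X" "\<And>n k. k \<in> ?K \<Longrightarrow> real n * NY (A (x n)) < NX (x n - k)"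
    by metis
  have K: "k \<in> X" "A k = 0" if "k \<in> ?K" for k
    using that unfolding kernel_on_def by auto
  have z: "\<exists>z\<in>X. NX z = 1 \<and> real n * NY (A z) \<le> 1 \<and> (\<forall>k\<in>?K. 1 \<le> 2 * NX (z - k))" for n
  proof -
    have "x n \<notin> ?K"
      using x(2)[of "x n" n] X.norm_zero Y.norm_zero K(2)[of "x n"] by auto
    then obtain k where k: "k \<in> ?K" "0 < NX (x n - k)"
      "\<And>w. w \<in> ?K \<Longrightarrow> NX (x n - k) \<le> 2 * NX (x n - k - w)"
      using X.almost_best_approximation[OF closedin_kernel subspace_kernel x(1)] by blast
    define r where "r = (of_real (NX (x n - k)) :: 'k)"
    define z where "z = smulX (inverse r) (x n - k)"
    have r: "r \<noteq> 0" "norm r = NX (x n - k)"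
      using k(2) unfolding r_def by auto
    have xk: "x n - k \<in> X" "A (x n - k) = A (x n)"
      using x(1) K[OF k(1)] X.X_diff A_diff by simp_all
    have zX: "z \<in> X"
      unfolding z_def using xk X.X_smul by blast
    have norm_z: "NX z = 1"
      unfolding z_def using r k(2) xk by (simp add: X.norm_smul norm_inverse)
    have norm_Az: "NY (A z) = NY (A (x n)) / NX (x n - k)"
      unfolding z_def A_smul[OF xk(1)] xk(2) using r x(1)
      by (simp add: Y.norm_smul A_in norm_inverse divide_inverse mult.commute)
    have Az: "real n * NY (A z) \<le> 1"
      using x(2)[OF k(1), of n] k(2) unfolding norm_Az by (simp add: pos_divide_le_eq)
    have "1 \<le> 2 * NX (z - w)" if w: "w \<in> ?K" for w
    proof -
      have rw: "smulX r w \<in> ?K"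
        using w subspace_kernel X.subspace_scale by blast
      have "x n - k - smulX r w = smulX r (z - w)"
        unfolding z_def using r(1) by (simp add: X.scale_right_diff_distrib)
      then have "NX (x n - k - smulX r w) = NX (x n - k) * NX (z - w)"
        using X.norm_smul[of "z - w" r] zX K(1)[OF w] X.X_diff r(2) by simp
      then show ?thesis
        using k(3)[OF rw] k(2) by simp
    qed
    then show ?thesis
      using zX norm_z Az by blast
  qed
  then obtain z where z: "\<And>n. z n \<in> X" "\<And>n. NX (z n) = 1" "\<And>n. real n * NY (A (z n)) \<le> 1"
    "\<And>n k. k \<in> ?K \<Longrightarrow> 1 \<le> 2 * NX (z n - k)"
    by metis
  have lim: "Y.converges (\<lambda>n. A (z (Suc n))) 0"
  proof (rule Y.converges_bound)
    show "NY (A (z (Suc n)) - 0) \<le> 1 / real (Suc n)" for n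
      using z(3)[of "Suc n"] by (simp add: field_simps)
    show "(\<lambda>n. 1 / real (Suc n)) \<longlonglongrightarrow> 0"
      by (rule LIMSEQ_Suc) (rule lim_1_over_n)
  qed (auto simp: z(1) A_in Y.X_zero)
  have bounded: "NX (z (Suc n)) \<le> 1" for n
    using z(2) by simp
  have "\<exists>l r. l \<in> X \<and> X.converges (\<lambda>n. z (Suc (r n))) l \<and> A l = 0"
    by (rule bounded_preimages_subseq[of "\<lambda>n. z (Suc n)", OF z(1) bounded Y.X_zero lim]) blast
  then obtain l r where l: "l \<in> X" "X.converges (\<lambda>n. z (Suc (r n))) l" "A l = 0"
    by blast
  then have "l \<in> ?K"
    unfolding kernel_on_def by blast
  then have "1 \<le> 2 * NX (z (Suc (r n)) - l)" for n
    by (rule z(4))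
  then have "1 / 2 \<le> NX (z (Suc (r n)) - l)" for n
    by (simp add: field_simps)
  then have "1 / 2 \<le> (0 :: real)"
    using LIMSEQ_le_const[OF l(2)] by blast
  then show False
    by simp
qed

text \<open>
  By \<open>dist_kernel_le\<close>, the preimages of a convergent sequence can be chosen bounded, so that
  \<open>bounded_preimages_subseq\<close> yields a preimage of the limit.
\<close>

lemma closedin_range: "closedin Y.mtopology (A ` X)"
proof (rule Y.closedin_if_converges)
  obtain c where c: "\<forall>x\<in>X. \<exists>k\<in>kernel_on X A. NX (x - k) \<le> c * NY (A x)"
    using dist_kernel_le by blast
  fix f y assume f: "\<And>n. f n \<in> A ` X" and y: "y \<in> Y" "Y.converges f y"
  have "\<exists>x\<in>X. A x = f n \<and> NX x \<le> c * NY (f n)" for n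
  proof -
    obtain x where x: "x \<in> X" "A x = f n"
      using f[of n] by auto
    then obtain k where "k \<in> X" "A k = 0" "NX (x - k) \<le> c * NY (f n)"
      using c unfolding kernel_on_def by force
    then show ?thesis
      using x A_diff X.X_diff by (intro bexI[of _ "x - k"]) auto
  qed
  then obtain x where x: "\<And>n. x n \<in> X" "\<And>n. A (x n) = f n" "\<And>n. NX (x n) \<le> c * NY (f n)"
    by metis
  have fY: "f n \<in> Y" for n
    using x(1,2)[of n] A_in by metis
  obtain K where K: "\<And>n. norm (NY (f n - y)) \<le> K"
    using convergent_imp_Bseq[OF convergentI[OF y(2)]] unfolding Bseq_def by blast
  have bounded: "NX (x n) \<le> \<bar>c\<bar> * (K + NY y)" for n
  proof -
    have "NY (f n) \<le> NY (f n - y) + NY y"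
      using Y.norm_triangle[of "f n - y" y] fY y(1) Y.X_diff by simp
    then have "NY (f n) \<le> K + NY y"
      using K[of n] by simp
    moreover have "c * NY (f n) \<le> \<bar>c\<bar> * NY (f n)"
      using Y.norm_nonneg[OF fY] by (intro mult_right_mono) auto
    ultimately show ?thesis
      using x(3)[of n] mult_left_mono[of "NY (f n)" "K + NY y" "\<bar>c\<bar>"] by simp
  qed
  have lim: "Y.converges (\<lambda>n. A (x n)) y"
    unfolding x(2) by (rule y(2))
  have "\<exists>l\<in>X. A l = y"
    by (rule bounded_preimages_subseq[of x, OF x(1) bounded y(1) lim]) blast
  then show "y \<in> A ` X"
    by blast
qed (use A_in in blast)

text \<open>
  The compact operator \<open>C\<close> is the identity on the kernel, whose unit ball is therefore totally bounded.
\<close>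

lemma finite_dim_kernel: "finite_dim_subspace smulX (kernel_on X A)"
proof -
  let ?K = "kernel_on X A"
  have "\<exists>F. finite F \<and> F \<subseteq> ?K \<and> (\<forall>y\<in>?K. \<exists>v\<in>X.span F. y - v \<in> {0})"
  proof (rule X.finite_codim_if_totally_bounded[where S = "C ` {x \<in> X. NX x \<le> 1}"])
    show "closedin X.mtopology {0}" "X.mtotally_bounded (C ` {x \<in> X. NX x \<le> 1})"
      by (rule X.closedin_zero, rule X.compact_operator_totally_bounded[OF C])
    show "X.subspace {0}" "{0} \<subseteq> ?K" "X.subspace ?K"
      using subspace_kernel X.subspace_0 by (auto simp: X.subspace_single_0)
    show "?K \<subseteq> X"
      unfolding kernel_on_def by blast
    show "\<exists>s\<in>C ` {x \<in> X. NX x \<le> 1} \<inter> ?K. y - s \<in> {0}" if y: "y \<in> ?K" "NX y \<le> 1" for y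
    proof
      show "y \<in> C ` {x \<in> X. NX x \<le> 1} \<inter> ?K"
        using y C_on_kernel[OF y(1)] unfolding kernel_on_def by force
    qed simp
  qed
  then obtain F where F: "finite F" "F \<subseteq> ?K" "\<And>y. y \<in> ?K \<Longrightarrow> y \<in> X.span F"
    by auto
  have "?K = X.span F"
    using F(3) X.span_minimal[OF F(2) subspace_kernel] by blast
  then show ?thesis
    using F(1) unfolding finite_dim_subspace_def by blast
qed

text \<open>
  If \<open>B\<close> is a right parametrix as well, then \<open>y\<close> and \<open>D y\<close> are congruent modulo the closed range
  of \<open>A\<close>, and \<open>D\<close> maps the unit ball to a totally bounded set.
\<close>

lemma finite_codim_range:
  assumes D: "compact_operator smulY smulY Y NY Y NY D"
    and D_eq: "\<And>y. y \<in> Y \<Longrightarrow> D y = y - A (B y)"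
  shows "\<exists>F. finite F \<and> F \<subseteq> Y \<and> (\<forall>y\<in>Y. \<exists>v\<in>Y.span F. y - v \<in> A ` X)"
proof (rule Y.finite_codim_if_totally_bounded[OF closedin_range subspace_range])
  show "Y.mtotally_bounded (D ` {y \<in> Y. NY y \<le> 1})"
    by (rule Y.compact_operator_totally_bounded[OF D])
  show "\<exists>s\<in>D ` {y \<in> Y. NY y \<le> 1} \<inter> Y. y - s \<in> A ` X" if y: "y \<in> Y" "NY y \<le> 1" for y
  proof
    show "D y \<in> D ` {y \<in> Y. NY y \<le> 1} \<inter> Y"
      using y D_eq A_in B_in Y.X_diff by auto
    show "y - D y \<in> A ` X"
      using y D_eq B_in by simp
  qed
qed (use A_in Y.subspace_X in auto)

text \<open>
  When the kernel is trivial, \<open>dist_kernel_le\<close> says that the inverse is bounded.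
\<close>

lemma invertible_if_bijective:
  assumes inj: "kernel_on X A = {0}" and surj: "A ` X = Y"
  shows "invertible_operator smulX smulY X NX Y NY A"
proof -
  interpret YX: normed_subspace_pair smulY Y NY smulX X NX ..
  have "inj_on A X"
  proof (rule inj_onI)
    fix x x' assume "x \<in> X" "x' \<in> X" "A x = A x'"
    then have "x - x' \<in> kernel_on X A"
      unfolding kernel_on_def using A_diff X.X_diff by simp
    then show "x = x'"
      using inj by simp
  qed
  define S where "S = the_inv_into X A"
  have SA: "S (A x) = x" if "x \<in> X" for x
    unfolding S_def using \<open>inj_on A X\<close> that by (rule the_inv_into_f_f)
  have AS: "S y \<in> X" "A (S y) = y" if y: "y \<in> Y" for y
    using y SA unfolding surj[symmetric] by auto
  have "linear_between smulY smulX Y X S"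
    unfolding linear_between_def
  proof (intro conjI ballI allI)
    show "S ` Y \<subseteq> X"
      using AS by blast
    show "S (y + y') = S y + S y'" if "y \<in> Y" "y' \<in> Y" for y y'
      using SA[of "S y + S y'"] AS that X.X_add by (simp add: A_add)
    show "S (smulY c y) = smulX c (S y)" if "y \<in> Y" for c y
      using SA[of "smulX c (S y)"] AS that X.X_smul by (simp add: A_smul)
  qed
  moreover obtain c where c: "\<forall>x\<in>X. \<exists>k\<in>kernel_on X A. NX (x - k) \<le> c * NY (A x)"
    using dist_kernel_le by blast
  moreover have "NX (S y) \<le> c * NY y" if "y \<in> Y" for y
    using c inj AS[OF that] by force
  ultimately have "continuous_operator smulY smulX Y NY X NX S"
    using YX.continuous_operator_if_bounded by blast
  then show ?thesis
    unfolding invertible_operator_def using A SA AS by blast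
qed

end

section \<open>Regularizing parametrices in families of Banach spaces\<close>

lemma admissible_familyD:
  assumes "admissible_family smul \<Sigma> H N" "s \<in> \<Sigma>"
  shows "normed_on smul (H s) (N s)"
    and "norm_topology (H s) (N s) closure_of H_infinity \<Sigma> H = H s"
    and "continuous_operator smul smul (H s) (N s) (H s) (N s) T \<Longrightarrow>
      T ` H s \<subseteq> H_infinity \<Sigma> H \<Longrightarrow> compact_operator smul smul (H s) (N s) (H s) (N s) T"
  using assms unfolding admissible_family_def banach_on_def by simp_all

lemma continuous_extensionsD:
  assumes "continuous_extensions smulX smulY \<Sigma> H N K M T Ts" "s \<in> \<Sigma>"
  shows "continuous_operator smulX smulY (H s) (N s) (K s) (M s) (Ts s)"
    and "x \<in> H_infinity \<Sigma> H \<Longrightarrow> Ts s x = T x"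
  using assms unfolding continuous_extensions_def by simp_all

text \<open>
  The extension \<open>C\<close> of \<open>1 - B A\<close> that the regularizing property supplies and the operator \<open>1 - Bs As\<close> are
  both continuous, and they agree on the dense subspace \<open>H_infinity\<close>. As the range of \<open>C\<close> lies in
  \<open>H_infinity\<close>, the family makes it compact.
\<close>

lemma regularizing_extension:
  fixes smulX :: "'k::{real_normed_field, heine_borel} \<Rightarrow> 'a::ab_group_add \<Rightarrow> 'a"
    and smulY :: "'k \<Rightarrow> 'b::ab_group_add \<Rightarrow> 'b"
  assumes H: "admissible_family smulX \<Sigma> H N" and K: "admissible_family smulY \<Sigma> K M"
    and A: "A ` H_infinity \<Sigma> H \<subseteq> H_infinity \<Sigma> K"
    and As: "continuous_extensions smulX smulY \<Sigma> H N K M A As"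
    and Bs: "continuous_extensions smulY smulX \<Sigma> K M H N B Bs"
    and reg: "regularizing smulX \<Sigma> H N (\<lambda>u. u - B (A u))"
    and s: "s \<in> \<Sigma>"
  shows "\<exists>C. compact_operator smulX smulX (H s) (N s) (H s) (N s) C \<and>
    C ` H s \<subseteq> H_infinity \<Sigma> H \<and> (\<forall>x\<in>H s. C x = x - Bs s (As s x))"
proof -
  interpret XY: normed_subspace_pair smulX "H s" "N s" smulY "K s" "M s"
    using admissible_familyD(1)[OF H s] admissible_familyD(1)[OF K s]
    by (intro normed_subspace_pair.intro normed_subspace.intro)
  interpret YX: normed_subspace_pair smulY "K s" "M s" smulX "H s" "N s" ..
  interpret XX: normed_subspace_pair smulX "H s" "N s" smulX "H s" "N s" ..
  obtain Cs where ext: "continuous_extensions smulX smulX \<Sigma> H N H N (\<lambda>u. u - B (A u)) Cs"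
    and "\<forall>s\<in>\<Sigma>. Cs s ` H s \<subseteq> H_infinity \<Sigma> H"
    using reg unfolding regularizing_def by blast
  then have im: "Cs s ` H s \<subseteq> H_infinity \<Sigma> H"
    using s by blast
  note A_cont = continuous_extensionsD(1)[OF As s] and B_cont = continuous_extensionsD(1)[OF Bs s]
    and C_cont = continuous_extensionsD(1)[OF ext s]
  have in_spaces: "As s x \<in> K s" "Cs s x \<in> H s" "Bs s (As s x) \<in> H s" if "x \<in> H s" for x
    using that A_cont B_cont C_cont unfolding continuous_operator_def linear_between_def
    by (simp_all add: image_subset_iff)
  have eq: "Cs s x = x - Bs s (As s x)" if x: "x \<in> H s" for x
  proof -
    have "x \<in> norm_topology (H s) (N s) closure_of H_infinity \<Sigma> H"
      using x unfolding admissible_familyD(2)[OF H s] .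
    then obtain f where f: "\<And>n. f n \<in> H_infinity \<Sigma> H \<inter> H s" "XY.X.converges f x"
      using XY.X.in_closure_converges by blast
    have fX: "f n \<in> H s" for n
      using f(1) by blast
    have Cf: "Cs s (f n) = f n - Bs s (As s (f n))" for n
    proof -
      have fI: "f n \<in> H_infinity \<Sigma> H"
        using f(1) by blast
      moreover have "A (f n) \<in> H_infinity \<Sigma> K"
        using fI A by blast
      ultimately show ?thesis
        using continuous_extensionsD(2)[OF As s] continuous_extensionsD(2)[OF Bs s]
          continuous_extensionsD(2)[OF ext s] by simp
    qed
    have "XY.Y.converges (\<lambda>n. As s (f n)) (As s x)"
      using fX x f(2) by (rule XY.continuous_operator_converges[OF A_cont])
    then have "XY.X.converges (\<lambda>n. Bs s (As s (f n))) (Bs s (As s x))"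
      using fX x in_spaces by (intro YX.continuous_operator_converges[OF B_cont]) simp_all
    then have "XY.X.converges (\<lambda>n. f n - Bs s (As s (f n))) (x - Bs s (As s x))"
      using fX x f(2) in_spaces by (intro XY.X.converges_diff) simp_all
    then have lim: "XY.X.converges (\<lambda>n. Cs s (f n)) (x - Bs s (As s x))"
      unfolding Cf .
    have lim': "XY.X.converges (\<lambda>n. Cs s (f n)) (Cs s x)"
      using fX x f(2) by (rule XX.continuous_operator_converges[OF C_cont])
    show ?thesis
      by (rule XY.X.converges_unique[OF _ _ _ lim' lim])
        (simp_all add: fX x in_spaces XY.X.X_diff)
  qed
  show ?thesis
    using admissible_familyD(3)[OF H s C_cont im] im eq by (intro exI[of _ "Cs s"] conjI ballI)
qed

locale regularizing_parametrix =
  fixes \<Sigma> :: "'s set"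
    and smul0 :: "'k::{real_normed_field, heine_borel} \<Rightarrow> 'a::ab_group_add \<Rightarrow> 'a"
    and smul1 :: "'k \<Rightarrow> 'b::ab_group_add \<Rightarrow> 'b"
    and H0 :: "'s \<Rightarrow> 'a set" and N0 :: "'s \<Rightarrow> 'a \<Rightarrow> real"
    and H1 :: "'s \<Rightarrow> 'b set" and N1 :: "'s \<Rightarrow> 'b \<Rightarrow> real"
    and A0 :: "'a \<Rightarrow> 'b" and A1 :: "'b \<Rightarrow> 'a"
    and A0s :: "'s \<Rightarrow> 'a \<Rightarrow> 'b" and A1s :: "'s \<Rightarrow> 'b \<Rightarrow> 'a"
  assumes family0: "admissible_family smul0 \<Sigma> H0 N0"
    and family1: "admissible_family smul1 \<Sigma> H1 N1"
    and A0: "linear_between smul0 smul1 (H_infinity \<Sigma> H0) (H_infinity \<Sigma> H1) A0"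
    and A1: "linear_between smul1 smul0 (H_infinity \<Sigma> H1) (H_infinity \<Sigma> H0) A1"
    and ext0: "continuous_extensions smul0 smul1 \<Sigma> H0 N0 H1 N1 A0 A0s"
    and ext1: "continuous_extensions smul1 smul0 \<Sigma> H1 N1 H0 N0 A1 A1s"
    and reg0: "regularizing smul0 \<Sigma> H0 N0 (\<lambda>u. u - A1 (A0 u))"
    and reg1: "regularizing smul1 \<Sigma> H1 N1 (\<lambda>u. u - A0 (A1 u))"
begin

sublocale VS0: vector_space smul0
  using family0 unfolding admissible_family_def by blast

sublocale VS1: vector_space smul1
  using family1 unfolding admissible_family_def by blast

abbreviation I0 :: "'a set" where "I0 \<equiv> H_infinity \<Sigma> H0"
abbreviation I1 :: "'b set" where "I1 \<equiv> H_infinity \<Sigma> H1"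

lemma I_subset: "s \<in> \<Sigma> \<Longrightarrow> I0 \<subseteq> H0 s" "s \<in> \<Sigma> \<Longrightarrow> I1 \<subseteq> H1 s"
  unfolding H_infinity_def by blast+

lemma A0_image: "A0 ` I0 \<subseteq> I1" and A1_image: "A1 ` I1 \<subseteq> I0"
  using A0 A1 unfolding linear_between_def by simp_all

lemma A0s_eq: "s \<in> \<Sigma> \<Longrightarrow> x \<in> I0 \<Longrightarrow> A0s s x = A0 x"
  and A1s_eq: "s \<in> \<Sigma> \<Longrightarrow> y \<in> I1 \<Longrightarrow> A1s s y = A1 y"
  using continuous_extensionsD(2)[OF ext0] continuous_extensionsD(2)[OF ext1] by simp_all

lemma parametrix:
  assumes s: "s \<in> \<Sigma>"
  obtains C where
    "left_parametrix smul0 (H0 s) (N0 s) smul1 (H1 s) (N1 s) (A0s s) (A1s s) C"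
proof -
  obtain C where C: "compact_operator smul0 smul0 (H0 s) (N0 s) (H0 s) (N0 s) C"
    "C ` H0 s \<subseteq> I0" "\<forall>x\<in>H0 s. C x = x - A1s s (A0s s x)"
    using regularizing_extension[OF family0 family1 A0_image ext0 ext1 reg0 s] by blast
  have "left_parametrix smul0 (H0 s) (N0 s) smul1 (H1 s) (N1 s) (A0s s) (A1s s) C"
  proof
    show "normed_on smul0 (H0 s) (N0 s)" "normed_on smul1 (H1 s) (N1 s)"
      by (rule admissible_familyD(1)[OF family0 s], rule admissible_familyD(1)[OF family1 s])
    show "continuous_operator smul0 smul1 (H0 s) (N0 s) (H1 s) (N1 s) (A0s s)"
      by (rule continuous_extensionsD(1)[OF ext0 s])
    show "continuous_operator smul1 smul0 (H1 s) (N1 s) (H0 s) (N0 s) (A1s s)"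
      by (rule continuous_extensionsD(1)[OF ext1 s])
  qed (use C in simp_all)
  then show ?thesis
    using that by blast
qed

lemma subspace_H1: "s \<in> \<Sigma> \<Longrightarrow> VS1.subspace (H1 s)"
  using admissible_familyD(1)[OF family1] unfolding normed_on_def by simp

lemma subspace_I1: "VS1.subspace I1"
  unfolding H_infinity_def using subspace_H1 by (intro VS1.subspace_Inter) auto

lemma subspace_range:
  assumes s: "s \<in> \<Sigma>"
  shows "VS1.subspace (A0s s ` H0 s)"
proof -
  obtain C where "left_parametrix smul0 (H0 s) (N0 s) smul1 (H1 s) (N1 s) (A0s s) (A1s s) C"
    using parametrix[OF s] .
  then show ?thesis
    by (rule left_parametrix.subspace_range)
qed

lemma range_subset: "s \<in> \<Sigma> \<Longrightarrow> A0s s ` H0 s \<subseteq> H1 s"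
  and A1s_image: "s \<in> \<Sigma> \<Longrightarrow> A1s s ` H1 s \<subseteq> H0 s"
  using continuous_extensionsD(1)[OF ext0] continuous_extensionsD(1)[OF ext1]
  unfolding continuous_operator_def linear_between_def by simp_all

lemma error0:
  assumes "s \<in> \<Sigma>" "x \<in> H0 s"
  shows "x - A1s s (A0s s x) \<in> I0"
proof -
  obtain C where C: "compact_operator smul0 smul0 (H0 s) (N0 s) (H0 s) (N0 s) C"
    "C ` H0 s \<subseteq> I0" "\<forall>x\<in>H0 s. C x = x - A1s s (A0s s x)"
    using regularizing_extension[OF family0 family1 A0_image ext0 ext1 reg0 assms(1)] by blast
  show ?thesis
    using C(2) C(3) assms(2) by (simp add: image_subset_iff)
qed

lemma error1:
  assumes "s \<in> \<Sigma>" "y \<in> H1 s"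
  shows "y - A0s s (A1s s y) \<in> I1"
proof -
  obtain D where D: "compact_operator smul1 smul1 (H1 s) (N1 s) (H1 s) (N1 s) D"
    "D ` H1 s \<subseteq> I1" "\<forall>y\<in>H1 s. D y = y - A0s s (A1s s y)"
    using regularizing_extension[OF family1 family0 A1_image ext1 ext0 reg1 assms(1)] by blast
  show ?thesis
    using D(2) D(3) assms(2) by (simp add: image_subset_iff)
qed

text \<open>
  Abstract elliptic regularity: in \<open>x = A1s (A0s x) + (1 - A1s A0s) x\<close> both summands are in \<open>I0\<close>.
\<close>

lemma regularity:
  assumes s: "s \<in> \<Sigma>" and x: "x \<in> H0 s" "A0s s x \<in> I1"
  shows "x \<in> I0"
proof -
  have "VS0.subspace (H0 t)" if "t \<in> \<Sigma>" for t
    using admissible_familyD(1)[OF family0 that] unfolding normed_on_def by blast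
  then have sub: "VS0.subspace I0"
    unfolding H_infinity_def by (intro VS0.subspace_Inter) auto
  have "A1s s (A0s s x) \<in> I0"
    using A1s_eq[OF s x(2)] A1_image x(2) by auto
  then have "(x - A1s s (A0s s x)) + A1s s (A0s s x) \<in> I0"
    by (rule VS0.subspace_add[OF sub error0[OF s x(1)]])
  then show ?thesis
    by simp
qed

lemma kernel_eq:
  assumes s: "s \<in> \<Sigma>"
  shows "kernel_on (H0 s) (A0s s) = kernel_on I0 A0"
proof -
  have "0 \<in> I1"
    using subspace_I1 by (rule VS1.subspace_0)
  then have "x \<in> I0" if "x \<in> H0 s" "A0s s x = 0" for x
    using regularity[OF s, of x] that by simp
  then show ?thesis
    using I_subset(1)[OF s] A0s_eq[OF s] unfolding kernel_on_def by fastforce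
qed

lemma range_Int:
  assumes s: "s \<in> \<Sigma>"
  shows "A0s s ` H0 s \<inter> I1 = A0 ` I0"
proof (intro equalityI subsetI)
  fix y assume "y \<in> A0s s ` H0 s \<inter> I1"
  then obtain x where x: "x \<in> H0 s" "y = A0s s x" "A0s s x \<in> I1"
    by blast
  then show "y \<in> A0 ` I0"
    using regularity[OF s x(1,3)] A0s_eq[OF s] by simp
next
  fix y assume "y \<in> A0 ` I0"
  then obtain x where x: "x \<in> I0" "y = A0 x"
    by blast
  then have "y = A0s s x" "x \<in> H0 s"
    using A0s_eq[OF s x(1)] I_subset(1)[OF s] by auto
  then show "y \<in> A0s s ` H0 s \<inter> I1"
    using x A0_image by blast
qed

lemma subspace_A0_image:
  assumes s: "s \<in> \<Sigma>"
  shows "VS1.subspace (A0 ` I0)"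
proof -
  have "VS1.subspace (A0s s ` H0 s \<inter> I1)"
    by (rule VS1.subspace_inter[OF subspace_range[OF s] subspace_I1])
  then show ?thesis
    unfolding range_Int[OF s] .
qed

text \<open>
  As \<open>H1 s = I1 + im A0s\<close> by \<open>error1\<close> and \<open>im A0s \<inter> I1 = A0 ` I0\<close>, the inclusion induces an isomorphism from
  \<open>I1 / A0 ` I0\<close> onto the cokernel of \<open>A0s s\<close>.
\<close>

lemma quotient_basis_transfer:
  assumes s: "s \<in> \<Sigma>" and B: "quotient_basis smul1 I1 (A0 ` I0) B"
  shows "quotient_basis smul1 (H1 s) (A0s s ` H0 s) B"
proof -
  let ?W = "A0s s ` H0 s"
  have sum_in: "(\<Sum>b\<in>B. smul1 (c b) b) \<in> I1" for c
    using VS1.quotient_basisD(2)[OF B] subspace_I1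
    by (intro VS1.subspace_sum VS1.subspace_scale) auto
  have "\<exists>c. y - (\<Sum>b\<in>B. smul1 (c b) b) \<in> ?W" if y: "y \<in> H1 s" for y
  proof -
    obtain c where "y - A0s s (A1s s y) - (\<Sum>b\<in>B. smul1 (c b) b) \<in> A0 ` I0"
      using VS1.quotient_basisD(3)[OF B error1[OF s y]] by blast
    then have "y - A0s s (A1s s y) - (\<Sum>b\<in>B. smul1 (c b) b) \<in> ?W"
      using range_Int[OF s] by blast
    moreover have "A0s s (A1s s y) \<in> ?W"
      using A1s_image[OF s] y by blast
    ultimately have "y - A0s s (A1s s y) - (\<Sum>b\<in>B. smul1 (c b) b) + A0s s (A1s s y) \<in> ?W"
      by (rule VS1.subspace_add[OF subspace_range[OF s]])
    then show ?thesis
      by (auto simp: algebra_simps)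
  qed
  moreover have "\<forall>b\<in>B. c b = 0" if "(\<Sum>b\<in>B. smul1 (c b) b) \<in> ?W" for c
  proof -
    have "(\<Sum>b\<in>B. smul1 (c b) b) \<in> A0 ` I0"
      using that sum_in[of c] range_Int[OF s] by blast
    then show ?thesis
      using VS1.quotient_basisD(4)[OF B] by blast
  qed
  ultimately show ?thesis
    unfolding quotient_basis_def
    using VS1.quotient_basisD(1,2)[OF B] I_subset(2)[OF s] by simp
qed

lemma quotient_basis_exists:
  assumes s: "s \<in> \<Sigma>"
  shows "\<exists>B. quotient_basis smul1 I1 (A0 ` I0) B"
proof -
  let ?W = "A0s s ` H0 s"
  obtain C where "left_parametrix smul0 (H0 s) (N0 s) smul1 (H1 s) (N1 s) (A0s s) (A1s s) C"
    using parametrix[OF s] .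
  then interpret left_parametrix smul0 "H0 s" "N0 s" smul1 "H1 s" "N1 s" "A0s s" "A1s s" C .
  obtain D where D: "compact_operator smul1 smul1 (H1 s) (N1 s) (H1 s) (N1 s) D"
    "D ` H1 s \<subseteq> I1" "\<forall>y\<in>H1 s. D y = y - A0s s (A1s s y)"
    using regularizing_extension[OF family1 family0 A1_image ext1 ext0 reg1 s] by blast
  obtain F where F: "finite F" "F \<subseteq> H1 s" "\<And>y. y \<in> H1 s \<Longrightarrow> \<exists>v\<in>VS1.span F. y - v \<in> ?W"
    using finite_codim_range[OF D(1) bspec[OF D(3)]] by blast
  have DF: "D ` F \<subseteq> I1"
    using D(2) F(2) by blast
  \<comment> \<open>Every \<open>f \<in> F\<close> is congruent to \<open>D f \<in> I1\<close>, so the spanning set can be moved into \<open>I1\<close>.\<close>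
  have "\<exists>v\<in>VS1.span (D ` F). y - v \<in> A0 ` I0" if y: "y \<in> I1" for y
  proof -
    obtain v where v: "v \<in> VS1.span F" "y - v \<in> ?W"
      using F(3)[of y] y I_subset(2)[OF s] by blast
    then obtain u where u: "v = (\<Sum>f\<in>F. smul1 (u f) f)"
      unfolding VS1.span_finite[OF F(1)] by blast
    define w where "w = (\<Sum>f\<in>F. smul1 (u f) (D f))"
    have w: "w \<in> VS1.span (D ` F)"
      unfolding w_def by (intro VS1.span_sum VS1.span_scale VS1.span_base imageI)
    have "v - w = (\<Sum>f\<in>F. smul1 (u f) (f - D f))"
      unfolding u w_def by (simp add: VS1.scale_right_diff_distrib sum_subtractf)
    also have "\<dots> \<in> ?W"
    proof (intro VS1.subspace_sum VS1.subspace_scale subspace_range)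
      fix f assume "f \<in> F"
      then have "f \<in> H1 s"
        using F(2) by blast
      then have "f - D f = A0s s (A1s s f)" "A1s s f \<in> H0 s"
        using D(3) A1s_image[OF s] by auto
      then show "f - D f \<in> ?W"
        by simp
    qed
    finally have "(y - v) + (v - w) \<in> ?W"
      by (rule VS1.subspace_add[OF subspace_range v(2)])
    moreover have "w \<in> I1"
      using w VS1.span_minimal[OF DF subspace_I1] by blast
    then have "y - w \<in> I1"
      by (rule VS1.subspace_diff[OF subspace_I1 y])
    ultimately have "y - w \<in> A0 ` I0"
      unfolding range_Int[OF s, symmetric] by simp
    then show ?thesis
      using w by blast
  qed
  then show ?thesis
    using VS1.quotient_basis_exists[of "D ` F" I1 "A0 ` I0"] F(1) DF subspace_A0_image[OF s]
    by blast
qed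

end

theorem proposition5p3:
  fixes \<Sigma> :: "(real ^ 'n) set"
    and smul0 :: "'k::{real_normed_field, heine_borel} \<Rightarrow> 'a::ab_group_add \<Rightarrow> 'a"
    and smul1 :: "'k \<Rightarrow> 'b::ab_group_add \<Rightarrow> 'b"
    and H0 :: "real ^ 'n \<Rightarrow> 'a set" and N0 :: "real ^ 'n \<Rightarrow> 'a \<Rightarrow> real"
    and H1 :: "real ^ 'n \<Rightarrow> 'b set" and N1 :: "real ^ 'n \<Rightarrow> 'b \<Rightarrow> real"
    and A0 :: "'a \<Rightarrow> 'b" and A1 :: "'b \<Rightarrow> 'a"
    and A0s :: "real ^ 'n \<Rightarrow> 'a \<Rightarrow> 'b" and A1s :: "real ^ 'n \<Rightarrow> 'b \<Rightarrow> 'a"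
  assumes "admissible_family smul0 \<Sigma> H0 N0"
    and "admissible_family smul1 \<Sigma> H1 N1"
    and "linear_between smul0 smul1 (H_infinity \<Sigma> H0) (H_infinity \<Sigma> H1) A0"
    and "linear_between smul1 smul0 (H_infinity \<Sigma> H1) (H_infinity \<Sigma> H0) A1"
    and "continuous_extensions smul0 smul1 \<Sigma> H0 N0 H1 N1 A0 A0s"
    and "continuous_extensions smul1 smul0 \<Sigma> H1 N1 H0 N0 A1 A1s"
    and "regularizing smul0 \<Sigma> H0 N0 (\<lambda>u. u - A1 (A0 u))"
    and "regularizing smul1 \<Sigma> H1 N1 (\<lambda>u. u - A0 (A1 u))"
  shows "(\<exists>V0 V1.
            finite_dim_subspace smul0 V0 \<and> V0 \<subseteq> H_infinity \<Sigma> H0 \<and>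
            finite_dim_subspace smul1 V1 \<and> V1 \<subseteq> H_infinity \<Sigma> H1 \<and>
            (\<forall>s\<in>\<Sigma>.
               kernel_on (H0 s) (A0s s) = V0 \<and>
               is_direct_sum (H1 s) V1 (A0s s ` H0 s) \<and>
               fredholm_operator smul0 smul1 (H0 s) (N0 s) (H1 s) (N1 s) (A0s s) \<and>
               index_of smul0 smul1 (H0 s) (H1 s) (A0s s) =
                 int (vector_space.dim smul0 V0) - int (vector_space.dim smul1 V1))) \<and>
         ((\<exists>s\<in>\<Sigma>. invertible_operator smul0 smul1 (H0 s) (N0 s) (H1 s) (N1 s) (A0s s)) \<longrightarrow>
          (\<forall>s\<in>\<Sigma>. invertible_operator smul0 smul1 (H0 s) (N0 s) (H1 s) (N1 s) (A0s s)))"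
proof -
  interpret regularizing_parametrix \<Sigma> smul0 smul1 H0 N0 H1 N1 A0 A1 A0s A1s
    by (rule regularizing_parametrix.intro) (fact assms)+
  show ?thesis
  proof (cases "\<Sigma> = {}")
    case True
    \<comment> \<open>Then \<open>H_infinity\<close> is the whole type and the kernel of \<open>A0\<close> may have infinite dimension, so
      \<open>V\<^sub>0\<close> cannot be chosen as below; any finite-dimensional spaces will do.\<close>
    have "finite_dim_subspace smul0 {0}" "finite_dim_subspace smul1 {0}"
      unfolding finite_dim_subspace_def by (auto intro!: exI[of _ "{}"])
    then show ?thesis
      using True unfolding H_infinity_def by auto
  next
    case False
    obtain B where B: "quotient_basis smul1 I1 (A0 ` I0) B"
      using False quotient_basis_exists by blast
    define V0 where "V0 = kernel_on I0 A0"
    define V1 where "V1 = VS1.span B"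
    have B_s: "quotient_basis smul1 (H1 s) (A0s s ` H0 s) B" if "s \<in> \<Sigma>" for s
      using that B by (rule quotient_basis_transfer)
    have kernel: "kernel_on (H0 s) (A0s s) = V0" if "s \<in> \<Sigma>" for s
      unfolding V0_def using that by (rule kernel_eq)
    have finite_V0: "finite_dim_subspace smul0 V0"
    proof -
      obtain s where s: "s \<in> \<Sigma>"
        using False by blast
      obtain C where "left_parametrix smul0 (H0 s) (N0 s) smul1 (H1 s) (N1 s) (A0s s) (A1s s) C"
        using parametrix[OF s] .
      then show ?thesis
        using left_parametrix.finite_dim_kernel kernel[OF s] by metis
    qed
    have finite_V1: "finite_dim_subspace smul1 V1"
      unfolding V1_def finite_dim_subspace_def using VS1.quotient_basisD(1)[OF B] by blast
    have V1: "V1 \<subseteq> I1"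
      unfolding V1_def using VS1.quotient_basisD(2)[OF B] subspace_I1 by (rule VS1.span_minimal)
    have V0: "V0 \<subseteq> I0"
      unfolding V0_def kernel_on_def by blast
    have direct_sum: "is_direct_sum (H1 s) V1 (A0s s ` H0 s)" if s: "s \<in> \<Sigma>" for s
      unfolding V1_def using B_s[OF s] subspace_range[OF s] range_subset[OF s] subspace_H1[OF s]
      by (rule VS1.is_direct_sum_span_quotient_basis)
    have fredholm: "fredholm_operator smul0 smul1 (H0 s) (N0 s) (H1 s) (N1 s) (A0s s)"
      if s: "s \<in> \<Sigma>" for s
      unfolding fredholm_operator_def kernel[OF s]
      using continuous_extensionsD(1)[OF ext0 s] finite_V0 B_s[OF s] by blast
    have index: "index_of smul0 smul1 (H0 s) (H1 s) (A0s s) =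
        int (VS0.dim V0) - int (VS1.dim V1)" if s: "s \<in> \<Sigma>" for s
      unfolding index_of_def kernel[OF s] V1_def
      using VS1.codim_eq_card[OF B_s[OF s] subspace_range[OF s]]
        VS1.dim_span_eq_card_independent[OF VS1.independent_quotient_basis[OF B_s[OF s] subspace_range[OF s]]]
      by simp
    \<comment> \<open>Invertibility at \<open>s\<close> forces \<open>V\<^sub>0 = V\<^sub>1 = {0}\<close>, hence bijectivity at every \<open>t\<close>.\<close>
    have invertible: "invertible_operator smul0 smul1 (H0 t) (N0 t) (H1 t) (N1 t) (A0s t)"
      if s: "s \<in> \<Sigma>" "invertible_operator smul0 smul1 (H0 s) (N0 s) (H1 s) (N1 s) (A0s s)"
        and t: "t \<in> \<Sigma>" for s t
    proof -
      obtain S where S: "continuous_operator smul1 smul0 (H1 s) (N1 s) (H0 s) (N0 s) S"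
        "\<forall>x\<in>H0 s. S (A0s s x) = x" "\<forall>y\<in>H1 s. A0s s (S y) = y"
        using s(2) unfolding invertible_operator_def by blast
      then have S_lin: "linear_between smul1 smul0 (H1 s) (H0 s) S"
        unfolding continuous_operator_def by blast
      have "S 0 = 0"
        using S_lin VS1.subspace_0[OF subspace_H1[OF s(1)]] by (rule linear_between_zero)
      then have "x = 0" if "x \<in> V0" for x
        using that S(2) unfolding kernel[OF s(1), symmetric] kernel_on_def by force
      moreover have "0 \<in> V0"
        using finite_V0 VS0.span_zero unfolding finite_dim_subspace_def by blast
      ultimately have "V0 = {0}"
        by blast
      have "S ` H1 s \<subseteq> H0 s"
        using S_lin unfolding linear_between_def by blast
      then have "H1 s \<subseteq> A0s s ` H0 s"
        using S(3) by (metis image_subset_iff rev_image_eqI subsetI)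
      then have "V1 \<subseteq> A0s s ` H0 s"
        using V1 I_subset(2)[OF s(1)] by blast
      moreover have "V1 \<inter> A0s s ` H0 s = {0}"
        using direct_sum[OF s(1)] unfolding is_direct_sum_def by (rule conjunct2)
      ultimately have "V1 = {0}"
        by (simp add: Int_absorb2)
      have "H1 t = {v + w |v w. v \<in> V1 \<and> w \<in> A0s t ` H0 t}"
        using direct_sum[OF t] unfolding is_direct_sum_def by (rule conjunct1)
      then have surj: "A0s t ` H0 t = H1 t"
        unfolding \<open>V1 = {0}\<close> by simp
      obtain C where
        "left_parametrix smul0 (H0 t) (N0 t) smul1 (H1 t) (N1 t) (A0s t) (A1s t) C"
        using parametrix[OF t] .
      then show ?thesis
        using kernel[OF t] surj unfolding \<open>V0 = {0}\<close> by (rule left_parametrix.invertible_if_bijective)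
    qed
    show ?thesis
      using finite_V0 finite_V1 V0 V1 kernel direct_sum fredholm index invertible by blast
  qed
qed

end
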